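(* There exist a hyperbolic matrix $A\in SL(2,\mathbb{Z})$, with associated semidirect product $G=\mathbb{Z}^2\rtimes_A\mathbb{Z}$, and an element $H\in\mathbb{C}[G]$ corresponding to a random walk on $G$, such that the Novikov–Shubin invariant of $H$ satisfies $\alpha(H)=0$.
   Context: $\mathbb{Z}^2\rtimes_A\mathbb{Z}$ is the semidirect product in which the generator of $\mathbb{Z}$ acts on $\mathbb{Z}^2$ by $A$; $A$ is hyperbolic if it has no eigenvalue of modulus $1$. "Corresponding to a random walk" means that $H$ is self-adjoint with nonnegative real coefficients, not all zero, i.e. a positive multiple of the transition operator of a symmetric random walk on $G$. A self-adjoint $H\in\mathbb{C}[G]$ acts by convolution as a bounded self-adjoint operator on $\ell^2(G)$; its spectral measure $\mu_H$ is the unique measure on $\mathbb{R}$ with $\langle\delta_e,H^k\delta_e\rangle=\int_{\mathbb{R}}x^k\,d\mu_H(x)$ for all $k\ge0$, where $\delta_e$ is the indicator of the identity. The Novikov–Shubin invariant is $$\alpha(H)=\liminf_{\varepsilon\to0^+}\frac{\log\big(\mu_H(-\varepsilon,\varepsilon)-\mu_H(\{0\})\big)}{\log\varepsilon}.$$ *)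

theory Defs
  imports "HOL-Analysis.Analysis" "HOL-Algebra.Group"
begin

section \<open>The groups \<open>\<int>\<^sup>2 \<rtimes>\<^sub>A \<int>\<close>\<close>

definition hyperbolic_matrix :: "int ^ 2 ^ 2 \<Rightarrow> bool" where
  "hyperbolic_matrix A \<longleftrightarrow>
     (\<forall>(l :: complex) (v :: complex ^ 2). v \<noteq> 0 \<and> map_matrix of_int A *v v = l *s v \<longrightarrow> cmod l \<noteq> 1)"

definition matrix_act :: "int ^ 2 ^ 2 \<Rightarrow> int \<Rightarrow> int ^ 2 \<Rightarrow> int ^ 2" where
  "matrix_act A n v =
     (if n \<ge> 0 then (((*v) A) ^^ nat n) v else (((*v) (matrix_inv A)) ^^ nat (- n)) v)"

text \<open>With this multiplication, conjugating \<open>(v, 0)\<close> by \<open>(0, 1)\<close> gives \<open>(A *v v, 0)\<close>.\<close>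

definition semidirect :: "int ^ 2 ^ 2 \<Rightarrow> ((int ^ 2) \<times> int) monoid" where
  "semidirect A =
     \<lparr>carrier = UNIV,
      monoid.mult = (\<lambda>(v, n) (w, m). (v + matrix_act A n w, n + m)),
      one = (0, 0)\<rparr>"

lemma matrix_inv_SL2:
  fixes A :: "int ^ 2 ^ 2"
  assumes "det A = 1"
  shows "A ** matrix_inv A = mat 1 \<and> matrix_inv A ** A = mat 1"
proof -
  define B :: "int ^ 2 ^ 2" where
    "B = vector [vector [A $ 2 $ 2, - A $ 1 $ 2], vector [- A $ 2 $ 1, A $ 1 $ 1]]"
  have "A $ 1 $ 1 * A $ 2 $ 2 - A $ 1 $ 2 * A $ 2 $ 1 = 1"
    using assms by (simp add: det_2)
  then have "A ** B = mat 1 \<and> B ** A = mat 1"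
    by (auto simp: B_def vec_eq_iff forall_2 matrix_matrix_mult_def sum_2 mat_def algebra_simps)
  then show ?thesis
    unfolding matrix_inv_def by (rule someI)
qed

lemma matrix_act_0 [simp]: "matrix_act A 0 v = v"
  by (simp add: matrix_act_def)

lemma matrix_act_Suc:
  assumes "det A = 1"
  shows "matrix_act A (n + 1) v = A *v matrix_act A n v"
proof (cases "n \<ge> 0")
  case True
  then show ?thesis by (simp add: matrix_act_def nat_add_distrib)
next
  case False
  then have "nat (- n) = Suc (nat (- (n + 1)))" by simp
  moreover have "A *v (matrix_inv A *v w) = w" for w
    using matrix_inv_SL2[OF assms] by (simp add: matrix_vector_mul_assoc)
  ultimately show ?thesis
    using False by (cases "n = -1") (simp_all add: matrix_act_def)
qed

lemma matrix_act_pred: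
  assumes "det A = 1"
  shows "matrix_act A (n - 1) v = matrix_inv A *v matrix_act A n v"
  using matrix_act_Suc[OF assms, of "n - 1" v] matrix_inv_SL2[OF assms]
  by (simp add: matrix_vector_mul_assoc)

lemma matrix_act_add:
  assumes "det A = 1"
  shows "matrix_act A (n + m) v = matrix_act A n (matrix_act A m v)"
proof (induction n rule: int_induct[where k = 0])
  case base
  then show ?case by simp
next
  case (step1 i)
  have "i + 1 + m = (i + m) + 1" by simp
  then show ?case by (simp only: matrix_act_Suc[OF assms] step1)
next
  case (step2 i)
  have "i - 1 + m = (i + m) - 1" by simp
  then show ?case by (simp only: matrix_act_pred[OF assms] step2)
qed

lemma matrix_act_plus:
  assumes "det A = 1"
  shows "matrix_act A n (v + w) = matrix_act A n v + matrix_act A n w"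
proof (induction n rule: int_induct[where k = 0])
  case base
  then show ?case by simp
next
  case (step1 i)
  then show ?case
    by (simp only: matrix_act_Suc[OF assms] matrix_vector_right_distrib)
next
  case (step2 i)
  then show ?case
    by (simp only: matrix_act_pred[OF assms] matrix_vector_right_distrib)
qed

lemma group_semidirect:
  assumes "det A = 1"
  shows "group (semidirect A)"
proof (rule groupI)
  show "\<exists>y\<in>carrier (semidirect A). y \<otimes>\<^bsub>semidirect A\<^esub> x = \<one>\<^bsub>semidirect A\<^esub>" for x
  proof (cases x)
    case (Pair v n)
    then show ?thesis
      by (intro bexI[of _ "(- matrix_act A (- n) v, - n)"]) (auto simp: semidirect_def)
  qed
qed (auto simp: semidirect_def matrix_act_add[OF assms] matrix_act_plus[OF assms] add.assoc)

section \<open>The complex group algebra\<close>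

definition group_algebra :: "('a, 'b) monoid_scheme \<Rightarrow> ('a \<Rightarrow> complex) set" where
  "group_algebra G = {f. finite {x. f x \<noteq> 0} \<and> {x. f x \<noteq> 0} \<subseteq> carrier G}"

definition self_adjoint :: "('a, 'b) monoid_scheme \<Rightarrow> ('a \<Rightarrow> complex) \<Rightarrow> bool" where
  "self_adjoint G H \<longleftrightarrow> (\<forall>g\<in>carrier G. H (inv\<^bsub>G\<^esub> g) = cnj (H g))"

definition corresponds_to_random_walk :: "('a, 'b) monoid_scheme \<Rightarrow> ('a \<Rightarrow> complex) \<Rightarrow> bool" where
  "corresponds_to_random_walk G H \<longleftrightarrow>
     H \<in> group_algebra G \<and> self_adjoint G H \<and>
     (\<forall>g\<in>carrier G. H g \<in> \<real>\<^sub>\<ge>\<^sub>0) \<and> (\<exists>g\<in>carrier G. H g \<noteq> 0)"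

section \<open>Spectral measure and Novikov--Shubin invariant\<close>

definition convolve ::
  "('a, 'b) monoid_scheme \<Rightarrow> ('a \<Rightarrow> complex) \<Rightarrow> ('a \<Rightarrow> complex) \<Rightarrow> 'a \<Rightarrow> complex" where
  "convolve G H f g = (\<Sum>h | h \<in> carrier G \<and> H h \<noteq> 0. H h * f (inv\<^bsub>G\<^esub> h \<otimes>\<^bsub>G\<^esub> g))"

definition ell2_inner ::
  "('a, 'b) monoid_scheme \<Rightarrow> ('a \<Rightarrow> complex) \<Rightarrow> ('a \<Rightarrow> complex) \<Rightarrow> complex" where
  "ell2_inner G f f' = (\<Sum>\<^sub>\<infinity>g\<in>carrier G. cnj (f g) * f' g)"

definition delta_one :: "('a, 'b) monoid_scheme \<Rightarrow> 'a \<Rightarrow> complex" where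
  "delta_one G g = (if g = \<one>\<^bsub>G\<^esub> then 1 else 0)"

text \<open>Integrability at \<open>k = 0\<close> forces the measure to be finite. For self-adjoint \<open>H\<close> the moments
  grow at most geometrically, so the measure exists and is unique among all Borel measures.\<close>

definition spectral_measure :: "('a, 'b) monoid_scheme \<Rightarrow> ('a \<Rightarrow> complex) \<Rightarrow> real measure" where
  "spectral_measure G H =
     (THE \<mu>. sets \<mu> = sets borel \<and>
       (\<forall>k::nat. integrable \<mu> (\<lambda>x. x ^ k) \<and>
          ell2_inner G (delta_one G) ((convolve G H ^^ k) (delta_one G))
            = complex_of_real (\<integral>x. x ^ k \<partial>\<mu>)))"

text \<open>The logarithm takes the value \<open>-\<infinity>\<close> at \<open>0\<close> (unlike \<^const>\<open>ln\<close>, which is \<open>0\<close> there), so that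
  the invariant is \<open>\<infinity>\<close> when the spectrum has a gap around \<open>0\<close>.\<close>

definition elog :: "real \<Rightarrow> ereal" where
  "elog x = (if x \<le> 0 then - \<infinity> else ereal (ln x))"

definition novikov_shubin :: "('a, 'b) monoid_scheme \<Rightarrow> ('a \<Rightarrow> complex) \<Rightarrow> ereal" where
  "novikov_shubin G H =
     Liminf (at_right 0) (\<lambda>\<epsilon>.
       elog (measure (spectral_measure G H) {- \<epsilon><..<\<epsilon>} - measure (spectral_measure G H) {0})
         / elog \<epsilon>)"

end

theory Submission
  imports Defs "HOL-Probability.Probability"
begin

text \<open>The group is the semidirect product by \<open>A = ((1, 2), (2, 5))\<close>, a symmetric matrix congruent to the
identity modulo 2, with eigenvalues \<open>\<rho> = 3 + 2 * sqrt 2\<close> and \<open>1 / \<rho>\<close>. The half-integer point \<open>p = (1/2, 1/2)\<close> of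
the dual torus is fixed by \<open>A\<close>. Let \<open>t\<close> generate the factor \<open>\<int>\<close>. The random walk is \<open>H = D\<^sup>* D\<close> with \<open>D = a + b t\<close>, where \<open>a\<close> and
\<open>b\<close> are elements of the group algebra of \<open>\<int>\<^sup>2\<close> with nonnegative coefficients of total sum 1. Both Fourier transforms vanish at
\<open>p\<close>, and the coefficients are chosen so that to first order at \<open>p\<close> and up to a constant the transform of \<open>a\<close> is the stable and that of
\<open>b\<close> the unstable eigencoordinate of \<open>A\<close>. This is why the irrational weight \<open>\<kappa> = 1 + sqrt 2\<close>, the slope of an
eigenvector, occurs.

A Fourier transform in \<open>\<int>\<^sup>2\<close> splits \<open>H\<close> into operators \<open>H\<^sub>y = D\<^sub>y\<^sup>* D\<^sub>y\<close> on sequences over \<open>\<int>\<close>, one for each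
\<open>y\<close> in the torus (centred at \<open>p\<close>). Here \<open>D\<^sub>y f n = \<alpha>\<^sub>n * f n + \<beta>\<^sub>n * f (n - 1)\<close>, where \<open>\<alpha>\<^sub>n\<close> and \<open>\<beta>\<^sub>n\<close> are the values of the
two transforms at \<open>p + A^(- n) y\<close>. Moments of the spectral measure \<open>\<mu>\<close> are averages over \<open>y\<close> of diagonal
entries of polynomials in \<open>H\<^sub>y\<close>, and every site of \<open>\<int>\<close> gives the same average because the trace is invariant under right
translation (\<open>integral_H_pow\<close>).

There is much spectrum near 0. Let both eigencoordinates of \<open>y\<close> have size about \<open>\<delta> = \<rho>^(- 3 * K)\<close>. Then the orbit stays near \<open>p\<close> for
\<open>\<bar>n\<bar> \<le> K\<close>, the stable coordinate dominates for \<open>n > 0\<close> and the unstable one for \<open>n < 0\<close>, so the quotients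
\<open>\<bar>\<beta>\<^sub>n / \<alpha>\<^sub>n\<bar>\<close> and \<open>\<bar>\<alpha>\<^sub>m / \<beta>\<^sub>m\<bar>\<close> with \<open>m = - n\<close> are at most \<open>5 * \<rho>^(- 2 * n)\<close>. The solution of \<open>D\<^sub>y f = 0\<close>, being a product of such quotients, decays
like a Gaussian on both sides of the site 0, and cutting it off at \<open>\<bar>n\<bar> \<le> K\<close> gives a vector with
\<open>\<parallel>D\<^sub>y f\<parallel>\<^sup>2\<close> of order \<open>\<rho>^(4 * K - 2 * K^2)\<close> (\<open>passage_quasimode\<close>). Such \<open>y\<close> fill a square of area \<open>\<delta>\<^sup>2\<close>. The price is therefore only
exponential in \<open>K\<close> while the gain is exponential in \<open>K\<^sup>2\<close>. This yields a mass of at least \<open>\<rho>^(- 8 * K - 9)\<close> in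
the interval of radius \<open>\<rho>^(- K^2)\<close>, and the quotient of the logarithms is at most \<open>(8 * K + 9) / K\<^sup>2\<close>, which tends to 0. Mass is
transferred from vectors to \<open>\<mu>\<close> through \<open>\<integral>(1 - x) ^ m \<partial>\<mu>\<close>: it is bounded below by the vectors
(\<open>trace_moment_lower_bound\<close>) and above by the mass near 0 (\<open>expectation_power_le\<close>).

None of this mass is an atom at 0. For almost every \<open>y\<close> all \<open>\<alpha>\<^sub>n\<close> are nonzero, so a solution of \<open>D\<^sub>y f = 0\<close> is determined by one entry and the
kernel projection of \<open>H\<^sub>y\<close> has rank at most 1. Its diagonal entries then sum to at most 1 over \<open>\<int>\<close>. Their averages over
\<open>y\<close> all equal \<open>\<mu> {0}\<close>, hence \<open>N * \<mu> {0} \<le> 1\<close> for all \<open>N\<close> (\<open>trace_moment_tendsto_0\<close>).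

Since \<open>0 \<le> H \<le> 1\<close>, the numbers \<open>\<langle>\<delta>, H\<^sup>k (1 - H)\<^sup>j \<delta>\<rangle>\<close> are nonnegative, and Hausdorff's theorem produces \<open>\<mu>\<close> as a measure on
the unit interval. That it is the only measure with these moments follows from the power series of its characteristic function.\<close>

section \<open>The Hausdorff moment problem\<close>

lemma sum_choose_Suc:
  fixes f :: "nat \<Rightarrow> real"
  shows "(\<Sum>k\<le>Suc N. real (Suc N choose k) * f k) =
         (\<Sum>k\<le>N. real (N choose k) * f k) + (\<Sum>k\<le>N. real (N choose k) * f (Suc k))"
proof -
  have "(\<Sum>k\<le>Suc N. real (Suc N choose k) * f k) = f 0 + (\<Sum>k\<le>N. real (Suc N choose Suc k) * f (Suc k))"
    by (subst sum.atMost_Suc_shift) simp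
  also have "\<dots> = f 0 + (\<Sum>k\<le>N. real (N choose Suc k) * f (Suc k)) + (\<Sum>k\<le>N. real (N choose k) * f (Suc k))"
    by (simp add: sum.distrib[symmetric] algebra_simps)
  also have "f 0 + (\<Sum>k\<le>N. real (N choose Suc k) * f (Suc k)) = (\<Sum>k\<le>Suc N. real (N choose k) * f k)"
    by (subst sum.atMost_Suc_shift) simp
  finally show ?thesis by simp
qed

text \<open>This is \<open>x\<^sup>j (1 - x)\<^sup>i * (x + (1 - x))\<^sup>N = x\<^sup>j (1 - x)\<^sup>i\<close>, with \<open>d k j\<close> in the place of
\<open>x\<^sup>k (1 - x)\<^sup>j\<close>.\<close>

lemma binomial_unfold:
  fixes d :: "nat \<Rightarrow> nat \<Rightarrow> real"
  assumes split: "\<And>k j. d k j = d (Suc k) j + d k (Suc j)"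
  shows "(\<Sum>k\<le>N. real (N choose k) * d (j + k) (i + (N - k))) = d j i"
proof (induction N arbitrary: i j)
  case (Suc N)
  have "(\<Sum>k\<le>Suc N. real (Suc N choose k) * d (j + k) (i + (Suc N - k)))
      = (\<Sum>k\<le>N. real (N choose k) * d (j + k) (i + (Suc N - k))) +
        (\<Sum>k\<le>N. real (N choose k) * d (j + Suc k) (i + (N - k)))"
    by (subst sum_choose_Suc) simp
  also have "(\<Sum>k\<le>N. real (N choose k) * d (j + k) (i + (Suc N - k)))
      = (\<Sum>k\<le>N. real (N choose k) * d (j + k) (Suc i + (N - k)))"
    by (intro sum.cong) (auto simp: Suc_diff_le)
  also have "\<dots> = d j (Suc i)" by (rule Suc.IH)
  also have "(\<Sum>k\<le>N. real (N choose k) * d (j + Suc k) (i + (N - k))) = d (Suc j) i"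
    using Suc.IH[of "Suc j" i] by simp
  finally show ?case using split[of j i] by simp
qed simp

lemma falling_factorial_choose:
  assumes "k \<le> n" "j \<le> n"
  shows "real (n choose k) * (\<Prod>i<j. (real k - real i) / (real n - real i)) =
         (if k < j then 0 else real ((n - j) choose (k - j)))"
proof (cases "k < j")
  case True
  then have "(\<Prod>i<j. (real k - real i) / (real n - real i)) = 0"
    by (intro prod_zero) auto
  then show ?thesis using True by simp
next
  case False
  have *: "(\<Prod>i<j. real m - real i) = fact j * real (m choose j)" for m
    by (simp add: binomial_gbinomial gbinomial_prod_rev lessThan_atLeast0)
  have "real (n choose k) * real (k choose j) = real (n choose j) * real ((n - j) choose (k - j))"
    using choose_mult[of j k n] False assms by (simp flip: of_nat_mult)
  moreover have "n choose j > 0" using assms by simp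
  ultimately show ?thesis using False
    by (simp add: prod_dividef * field_simps)
qed

text \<open>Factors with \<open>k < i\<close> are negative, but \<open>2 * j < n\<close> keeps them above \<open>-1\<close>, so two products of numbers of modulus at most 1 are
compared.\<close>

lemma falling_factorial_ratio_approx:
  assumes "2 * j < n" "k \<le> n"
  shows "\<bar>(\<Prod>i<j. (real k - real i) / (real n - real i)) - (real k / real n) ^ j\<bar> \<le> real j * real j / (real n - real j)"
proof -
  have n: "real n > 0" "real n - real j > 0" using assms by auto
  have "norm ((\<Prod>i<j. (real k - real i) / (real n - real i)) - (\<Prod>i<j. real k / real n))
      \<le> (\<Sum>i<j. norm ((real k - real i) / (real n - real i) - real k / real n))"
  proof (rule norm_prod_diff)
    fix i assume "i \<in> {..<j}"
    then show "norm ((real k - real i) / (real n - real i)) \<le> 1"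
      using assms by (auto simp: abs_le_iff field_simps)
    show "norm (real k / real n) \<le> 1" using assms by (auto simp: field_simps)
  qed
  also have "\<dots> \<le> (\<Sum>i<j. real j / (real n - real j))"
  proof (rule sum_mono)
    fix i assume i: "i \<in> {..<j}"
    then have ni: "real n - real i > 0" using assms by auto
    have "(real k - real i) / (real n - real i) - real k / real n
        = - (real i / (real n - real i) * ((real n - real k) / real n))"
      using ni n by (simp add: field_simps)
    then have "norm ((real k - real i) / (real n - real i) - real k / real n) =
        real i / (real n - real i) * ((real n - real k) / real n)"
      using ni n assms by (simp add: abs_mult)
    also have "\<dots> \<le> real i / (real n - real i) * 1"
      using ni n assms by (intro mult_left_mono) (auto simp: field_simps)
    also have "\<dots> \<le> real j / (real n - real j)"
      using i ni n by (simp add: frac_le)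
    finally show "norm ((real k - real i) / (real n - real i) - real k / real n) \<le> real j / (real n - real j)" .
  qed
  finally show ?thesis by simp
qed

text \<open>If \<open>d k j\<close> is the integral of \<open>x\<^sup>k (1 - x)\<^sup>j\<close>, then the weights are the integrals of the Bernstein basis
polynomials, so that integrating \<open>f\<close> against this measure amounts to integrating the \<open>n\<close>-th Bernstein polynomial of \<open>f\<close>.\<close>

definition bernstein_measure :: "(nat \<Rightarrow> nat \<Rightarrow> real) \<Rightarrow> nat \<Rightarrow> real measure" where
  "bernstein_measure d n =
     distr (point_measure {..n} (\<lambda>k. ennreal (real (n choose k) * d k (n - k)))) borel (\<lambda>k. real k / real n)"

context
  fixes d :: "nat \<Rightarrow> nat \<Rightarrow> real"
  assumes nonneg: "\<And>k j. d k j \<ge> 0"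
    and total: "d 0 0 = 1"
    and split: "\<And>k j. d k j = d (Suc k) j + d k (Suc j)"
begin

lemma bernstein_measure_real_distribution: "real_distribution (bernstein_measure d n)"
proof -
  let ?P = "point_measure {..n} (\<lambda>k. ennreal (real (n choose k) * d k (n - k)))"
  have "emeasure ?P (space ?P) = (\<Sum>k\<le>n. ennreal (real (n choose k) * d k (n - k)))"
    by (simp add: space_point_measure emeasure_point_measure_finite)
  also have "\<dots> = ennreal (\<Sum>k\<le>n. real (n choose k) * d k (n - k))"
    using nonneg by (intro sum_ennreal) simp
  also have "(\<Sum>k\<le>n. real (n choose k) * d k (n - k)) = 1"
    using binomial_unfold[of d n 0 0, OF split] total by simp
  finally interpret prob_space ?P
    by (intro prob_spaceI) simp
  show ?thesis unfolding bernstein_measure_def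
    by (intro real_distribution_distr) (simp add: measurable_def space_point_measure sets_point_measure)
qed

lemma integral_bernstein_measure:
  assumes [measurable]: "g \<in> borel_measurable borel"
  shows "integral\<^sup>L (bernstein_measure d n) (g :: real \<Rightarrow> real) =
     (\<Sum>k\<le>n. real (n choose k) * d k (n - k) * g (real k / real n))"
proof -
  let ?P = "point_measure {..n} (\<lambda>k. ennreal (real (n choose k) * d k (n - k)))"
  have "(\<lambda>k. real k / real n) \<in> measurable ?P borel"
    by (simp add: measurable_def space_point_measure sets_point_measure)
  from integral_distr[OF this assms] show ?thesis
    unfolding bernstein_measure_def
    by (simp add: lebesgue_integral_point_measure_finite nonneg)
qed

text \<open>The normalised falling factorial of degree \<open>j\<close> has integral exactly \<open>d j 0\<close>, since it shifts binomial coefficients, and it differs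
from the power by \<open>O(1 / n)\<close> uniformly on the support.\<close>

lemma bernstein_measure_moments:
  "(\<lambda>n. \<Sum>k\<le>n. (n choose k) * d k (n - k) * (real k / real n) ^ j) \<longlonglongrightarrow> d j 0"
proof -
  have "(\<lambda>n. (\<Sum>k\<le>n. real (n choose k) * d k (n - k) * (real k / real n) ^ j) - d j 0) \<longlonglongrightarrow> 0"
  proof (rule Lim_null_comparison)
    show "(\<lambda>n. real j * real j / (real n - real j)) \<longlonglongrightarrow> 0" by real_asymp
    show "\<forall>\<^sub>F n in sequentially. norm ((\<Sum>k\<le>n. real (n choose k) * d k (n - k) * (real k / real n) ^ j) - d j 0)
        \<le> real j * real j / (real n - real j)"
      using eventually_gt_at_top[of "2 * j"]
    proof eventually_elim
      case (elim n)
      let ?q = "\<lambda>k. real (n choose k) * d k (n - k)"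
      let ?r = "\<lambda>k. \<Prod>i<j. (real k - real i) / (real n - real i)"
      have "(\<Sum>k\<le>n. ?q k * ?r k) = (\<Sum>k\<le>n. if k < j then 0 else real ((n - j) choose (k - j)) * d k (n - k))"
      proof (intro sum.cong refl)
        fix k assume "k \<in> {..n}"
        then have "?q k * ?r k = d k (n - k) * (real (n choose k) * ?r k)" by simp
        also have "\<dots> = (if k < j then 0 else real ((n - j) choose (k - j)) * d k (n - k))"
          using \<open>k \<in> {..n}\<close> elim by (subst falling_factorial_choose) auto
        finally show "?q k * ?r k = \<dots>" .
      qed
      also have "\<dots> = (\<Sum>k\<in>{j..n}. real ((n - j) choose (k - j)) * d k (n - k))"
        by (intro sum.mono_neutral_cong_right) auto
      also have "\<dots> = (\<Sum>k\<le>n - j. real ((n - j) choose k) * d (j + k) (0 + ((n - j) - k)))"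
        using elim by (intro sum.reindex_bij_witness[of _ "\<lambda>k. j + k" "\<lambda>k. k - j"]) auto
      also have "\<dots> = d j 0" by (rule binomial_unfold[of d, OF split])
      finally have "d j 0 = (\<Sum>k\<le>n. ?q k * ?r k)" ..
      then have "norm ((\<Sum>k\<le>n. ?q k * (real k / real n) ^ j) - d j 0)
          = norm (\<Sum>k\<le>n. ?q k * ((real k / real n) ^ j - ?r k))"
        by (simp add: sum_subtractf right_diff_distrib)
      also have "\<dots> \<le> (\<Sum>k\<le>n. ?q k * (real j * real j / (real n - real j)))"
      proof (rule order.trans[OF norm_sum], rule sum_mono)
        fix k assume "k \<in> {..n}"
        then show "norm (?q k * ((real k / real n) ^ j - ?r k)) \<le> ?q k * (real j * real j / (real n - real j))"
          using falling_factorial_ratio_approx[of j n k] elim nonneg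
          by (simp add: abs_mult mult_left_mono abs_minus_commute del: times_divide_eq_right)
      qed
      also have "\<dots> = (\<Sum>k\<le>n. ?q k) * (real j * real j / (real n - real j))"
        by (rule sum_distrib_right[symmetric])
      also have "(\<Sum>k\<le>n. ?q k) = 1"
        using binomial_unfold[of d n 0 0, OF split] total by simp
      finally show ?case by simp
    qed
  qed
  then show ?thesis by (simp add: LIM_zero_iff)
qed

text \<open>A weak limit of the Bernstein measures, which exists by Helly's selection theorem because they all live on the unit interval.\<close>

theorem hausdorff_moment:
  "\<exists>M. real_distribution M \<and> (AE x in M. 0 \<le> x \<and> x \<le> 1) \<and> (\<forall>k. integral\<^sup>L M (\<lambda>x. x ^ k) = d k 0)"
proof -
  let ?N = "bernstein_measure d"
  have AE_N: "AE x in ?N n. 0 \<le> x \<and> x \<le> 1" for n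
    unfolding bernstein_measure_def
    by (subst AE_distr_iff)
       (auto simp: measurable_def space_point_measure sets_point_measure AE_point_measure divide_le_eq_1)
  have "tight ?N"
    unfolding tight_def
  proof (intro conjI allI impI)
    show "real_distribution (?N n)" for n by (rule bernstein_measure_real_distribution)
    fix e :: real assume "e > 0"
    have "measure (?N n) {-1<..1} = 1" for n
    proof -
      interpret real_distribution "?N n" by (rule bernstein_measure_real_distribution)
      show ?thesis using AE_N[of n] by (subst prob_eq_1) (auto elim!: eventually_mono)
    qed
    then show "\<exists>a b. a < b \<and> (\<forall>n. 1 - e < measure (?N n) {a<..b})"
      using \<open>e > 0\<close> by (intro exI[of _ "-1"] exI[of _ 1]) auto
  qed
  from tight_imp_convergent_subsubsequence[OF this strict_mono_id]
  obtain r M where r: "strict_mono r" and M: "real_distribution M" "weak_conv_m (?N \<circ> id \<circ> r) M"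
    by blast
  interpret M: real_distribution M by fact
  interpret N: real_distribution "?N n" for n by (rule bernstein_measure_real_distribution)
  have "real_distribution ((?N \<circ> id \<circ> r) n)" for n
    by (simp add: bernstein_measure_real_distribution)
  note conv = weak_conv_imp_integral_bdd_continuous_conv[OF this M(1) M(2)]
  \<comment> \<open>the distance to the unit interval, cut off at 1\<close>
  define dist01 :: "real \<Rightarrow> real" where "dist01 x = min 1 (max 0 (max (- x) (x - 1)))" for x
  have cont_dist01: "isCont dist01 x" for x
    unfolding dist01_def by (intro continuous_intros)
  have [measurable]: "dist01 \<in> borel_measurable borel" unfolding dist01_def by measurable
  have "(\<lambda>n. integral\<^sup>L ((?N \<circ> id \<circ> r) n) dist01) \<longlonglongrightarrow> integral\<^sup>L M dist01"
    by (rule conv[where B = 1]) (auto simp: cont_dist01 dist01_def)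
  moreover have "integral\<^sup>L ((?N \<circ> id \<circ> r) n) dist01 = 0" for n
  proof -
    have "AE x in ?N (r n). dist01 x = 0" using AE_N[of "r n"] by eventually_elim (auto simp: dist01_def)
    then show ?thesis by (simp add: integral_eq_zero_AE)
  qed
  ultimately have "integral\<^sup>L M dist01 = 0" by (simp add: LIMSEQ_const_iff)
  moreover have "integrable M dist01"
    by (rule M.integrable_const_bound[of _ 1]) (auto simp: dist01_def)
  ultimately have "AE x in M. dist01 x = 0"
    by (subst (asm) integral_nonneg_eq_0_iff_AE) (auto simp: dist01_def)
  then have AE_M: "AE x in M. 0 \<le> x \<and> x \<le> 1"
    by eventually_elim (auto simp: dist01_def min_def max_def split: if_splits)
  have "integral\<^sup>L M (\<lambda>x. x ^ k) = d k 0" for k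
  proof -
    define g :: "real \<Rightarrow> real" where "g x = (max 0 (min 1 x)) ^ k" for x
    have cont_g: "isCont g x" for x
      unfolding g_def by (intro continuous_intros)
    have [measurable]: "g \<in> borel_measurable borel" unfolding g_def by measurable
    have 1: "(\<lambda>n. integral\<^sup>L ((?N \<circ> id \<circ> r) n) g) \<longlonglongrightarrow> integral\<^sup>L M g"
      by (rule conv[where B = 1]) (auto simp: cont_g g_def intro!: power_le_one)
    have "integral\<^sup>L (?N n) g = (\<Sum>k'\<le>n. real (n choose k') * d k' (n - k') * (real k' / real n) ^ k)" for n
      by (subst integral_bernstein_measure)
         (auto intro!: sum.cong simp: g_def min_def max_def le_divide_eq_1)
    then have "(\<lambda>n. integral\<^sup>L (?N n) g) \<longlonglongrightarrow> d k 0"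
      using bernstein_measure_moments[of k] by simp
    from LIMSEQ_subseq_LIMSEQ[OF this r] have "integral\<^sup>L M g = d k 0"
      using 1 by (simp add: o_def LIMSEQ_unique)
    moreover have "AE x in M. g x = x ^ k"
      using AE_M by eventually_elim (auto simp: g_def)
    then have "integral\<^sup>L M g = integral\<^sup>L M (\<lambda>x. x ^ k)"
      by (intro integral_cong_AE) auto
    ultimately show ?thesis by simp
  qed
  with M AE_M show ?thesis by blast
qed

end

text \<open>Moments bounded by 1 make the Taylor series of the characteristic function converge to it everywhere.\<close>

lemma moments_determine_measure:
  fixes \<mu> \<nu> :: "real measure"
  assumes "real_distribution \<mu>" "real_distribution \<nu>"
    and int: "\<And>k. integrable \<mu> (\<lambda>x. x ^ k)" "\<And>k. integrable \<nu> (\<lambda>x. x ^ k)"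
    and eq: "\<And>k. integral\<^sup>L \<mu> (\<lambda>x. x ^ k) = integral\<^sup>L \<nu> (\<lambda>x. x ^ k)"
    and bound: "\<And>k. integral\<^sup>L \<nu> (\<lambda>x. x ^ k) \<le> 1"
  shows "\<mu> = \<nu>"
proof (rule Levy_uniqueness[OF assms(1,2)], rule ext)
  fix t
  define S where "S n = (\<Sum>k\<le>n. ((\<i> * complex_of_real t) ^ k / fact k) * complex_of_real (integral\<^sup>L \<nu> (\<lambda>x. x ^ k)))" for n
  have lim: "(\<lambda>n. S (2 * n)) \<longlonglongrightarrow> char M t"
    if M: "real_distribution M" "\<And>k. integrable M (\<lambda>x. x ^ k)" "\<And>k. integral\<^sup>L M (\<lambda>x. x ^ k) = integral\<^sup>L \<nu> (\<lambda>x. x ^ k)"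
    for M
  proof -
    interpret real_distribution M by fact
    have "(\<lambda>n. S (2 * n) - char M t) \<longlonglongrightarrow> 0"
    proof (rule Lim_null_comparison)
      show "\<forall>\<^sub>F n in sequentially. norm (S (2 * n) - char M t) \<le> 2 * (\<bar>t\<bar> ^ (2 * n) / fact (2 * n))"
      proof (intro always_eventually allI)
        fix n
        have "norm (S (2 * n) - char M t) \<le> (2 * \<bar>t\<bar> ^ (2 * n) / fact (2 * n)) * expectation (\<lambda>x. \<bar>x\<bar> ^ (2 * n))"
          using char_approx1[where n = "2 * n" and t = t, OF M(2)] by (simp add: S_def M(3) norm_minus_commute)
        also have "expectation (\<lambda>x. \<bar>x\<bar> ^ (2 * n)) = expectation (\<lambda>x. x ^ (2 * n))"
          by (simp add: power_mult)
        also have "(2 * \<bar>t\<bar> ^ (2 * n) / fact (2 * n)) * expectation (\<lambda>x. x ^ (2 * n)) \<le> (2 * \<bar>t\<bar> ^ (2 * n) / fact (2 * n)) * 1"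
          unfolding M(3) by (intro mult_left_mono bound) simp
        finally show "norm (S (2 * n) - char M t) \<le> 2 * (\<bar>t\<bar> ^ (2 * n) / fact (2 * n))" by simp
      qed
      have "(\<lambda>n. inverse (fact n) * \<bar>t\<bar> ^ n) \<longlonglongrightarrow> 0"
        by (intro summable_LIMSEQ_zero summable_exp)
      then have "(\<lambda>n. \<bar>t\<bar> ^ n / fact n) \<longlonglongrightarrow> 0"
        by (simp add: divide_inverse mult.commute)
      from LIMSEQ_subseq_LIMSEQ[OF this, of "\<lambda>n. 2 * n"]
      show "(\<lambda>n. 2 * (\<bar>t\<bar> ^ (2 * n) / fact (2 * n))) \<longlonglongrightarrow> 0"
        by (intro tendsto_mult_right_zero) (simp add: strict_mono_def o_def)
    qed
    then show ?thesis by (simp add: LIM_zero_iff)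
  qed
  show "char \<mu> t = char \<nu> t"
    by (rule LIMSEQ_unique[OF lim[OF assms(1) int(1) eq] lim[OF assms(2) int(2) refl]])
qed

locale unit_interval_distribution = real_distribution +
  assumes AE_unit: "AE x in M. 0 \<le> x \<and> x \<le> 1"
begin

lemma integrable_mono: "integrable M (\<lambda>x. x ^ k * (1 - x) ^ j)"
proof (rule integrable_const_bound[of _ 1])
  show "AE x in M. norm (x ^ k * (1 - x) ^ j) \<le> 1"
    using AE_unit by eventually_elim (auto simp: abs_mult power_abs intro!: mult_le_one power_le_one)
qed auto

lemma mixed_moments:
  assumes split: "\<And>k j. d k j = d (Suc k) j + d k (Suc j)"
    and d: "\<And>k. expectation (\<lambda>x. x ^ k) = d k 0"
  shows "expectation (\<lambda>x. x ^ k * (1 - x) ^ j) = d k j"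
proof (induction j arbitrary: k)
  case (Suc j)
  have "expectation (\<lambda>x. x ^ k * (1 - x) ^ Suc j)
      = expectation (\<lambda>x. x ^ k * (1 - x) ^ j - x ^ Suc k * (1 - x) ^ j)"
    by (simp add: algebra_simps)
  also have "\<dots> = d k j - d (Suc k) j"
    using integrable_mono[of k j] integrable_mono[of "Suc k" j] Suc[of k] Suc[of "Suc k"]
    by (subst Bochner_Integration.integral_diff) auto
  finally show ?case using split[of k j] by simp
qed (simp add: d)

lemma measure_0_le: "measure M {0} \<le> expectation (\<lambda>x. (1 - x) ^ m)"
proof -
  have "measure M {0} = expectation (indicator {0})" by simp
  also have "\<dots> \<le> expectation (\<lambda>x. (1 - x) ^ m)"
  proof (intro integral_mono_AE)
    show "AE x in M. indicator {0} x \<le> (1 - x) ^ m"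
      using AE_unit by eventually_elim (auto simp: indicator_def)
    show "integrable M (indicator {0} :: real \<Rightarrow> real)"
      by (rule integrable_const_bound[of _ 1]) auto
  qed (use integrable_mono[of 0 m] in auto)
  finally show ?thesis .
qed

lemma expectation_power_le:
  assumes "0 < \<epsilon>" "\<epsilon> \<le> 1"
  shows "expectation (\<lambda>x. (1 - x) ^ m) \<le> measure M {- \<epsilon><..<\<epsilon>} + (1 - \<epsilon>) ^ m"
proof -
  have ind: "integrable M (indicator {- \<epsilon><..<\<epsilon>} :: real \<Rightarrow> real)"
    by (rule integrable_const_bound[of _ 1]) auto
  have "expectation (\<lambda>x. (1 - x) ^ m) \<le> expectation (\<lambda>x. indicator {- \<epsilon><..<\<epsilon>} x + (1 - \<epsilon>) ^ m)"
  proof (intro integral_mono_AE)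
    show "AE x in M. (1 - x) ^ m \<le> indicator {- \<epsilon><..<\<epsilon>} x + (1 - \<epsilon>) ^ m"
      using AE_unit
    proof eventually_elim
      case (elim x)
      show ?case
      proof (cases "x < \<epsilon>")
        case True
        then show ?thesis using elim assms power_le_one[of "1 - x" m] by (simp add: add_increasing2)
      next
        case False
        then show ?thesis using elim by (auto simp: indicator_def intro!: power_mono)
      qed
    qed
    show "integrable M (\<lambda>x. indicator {- \<epsilon><..<\<epsilon>} x + (1 - \<epsilon>) ^ m)"
      using ind by simp
  qed (use integrable_mono[of 0 m] in auto)
  also have "\<dots> = measure M {- \<epsilon><..<\<epsilon>} + (1 - \<epsilon>) ^ m"
    using ind prob_space by (subst Bochner_Integration.integral_add) auto
  finally show ?thesis .
qed

end

text \<open>Multiply by Bernoulli's bound \<open>m * \<epsilon> \<le> (1 + \<epsilon>)\<^sup>m\<close>.\<close>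

lemma one_minus_power_le:
  fixes \<epsilon> :: real
  assumes "0 < \<epsilon>" "\<epsilon> \<le> 1" "m > 0"
  shows "(1 - \<epsilon>) ^ m \<le> 1 / (real m * \<epsilon>)"
proof -
  have "real m * \<epsilon> \<le> (1 + \<epsilon>) ^ m"
    using Bernoulli_inequality[of \<epsilon> m] assms by simp
  then have "(1 - \<epsilon>) ^ m * (real m * \<epsilon>) \<le> (1 - \<epsilon>) ^ m * (1 + \<epsilon>) ^ m"
    using assms by (intro mult_left_mono) auto
  also have "\<dots> = (1 - \<epsilon>\<^sup>2) ^ m"
    by (simp add: power_mult_distrib[symmetric] power2_eq_square algebra_simps)
  also have "\<dots> \<le> 1"
    using assms by (intro power_le_one) (auto simp: power_le_one)
  finally show ?thesis using assms by (simp add: field_simps)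
qed

section \<open>Bidiagonal operators on the integers\<close>

text \<open>Polynomials in a banded operator map finitely supported sequences to finitely supported sequences. All the operator theory
takes place on these, with the inner product below, which is conjugate linear in its first argument and sums over the support of that argument.\<close>

definition fin_supp :: "(int \<Rightarrow> complex) \<Rightarrow> bool" where
  "fin_supp f \<longleftrightarrow> finite {n. f n \<noteq> 0}"

definition ip :: "(int \<Rightarrow> complex) \<Rightarrow> (int \<Rightarrow> complex) \<Rightarrow> complex" where
  "ip f g = (\<Sum>n | f n \<noteq> 0. cnj (f n) * g n)"

definition unit_vec :: "int \<Rightarrow> int \<Rightarrow> complex" where
  "unit_vec j n = (if n = j then 1 else 0)"

lemma fin_supp_unit_vec [simp]: "fin_supp (unit_vec j)"
  by (simp add: fin_supp_def unit_vec_def)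

lemma ip_eq_sum:
  assumes "finite S" "\<And>n. n \<notin> S \<Longrightarrow> f n = 0"
  shows "ip f g = (\<Sum>n\<in>S. cnj (f n) * g n)"
  unfolding ip_def using assms by (intro sum.mono_neutral_left) auto

lemma ip_unit_vec [simp]: "ip (unit_vec i) g = g i"
  using ip_eq_sum[of "{i}" "unit_vec i" g] by (simp add: unit_vec_def)

lemma ip_diff_right: "ip f (\<lambda>n. g n - h n) = ip f g - ip f h"
  by (simp add: ip_def sum_subtractf algebra_simps)

lemma ip_commute:
  assumes "fin_supp f" "fin_supp g"
  shows "ip g f = cnj (ip f g)"
proof -
  let ?S = "{n. f n \<noteq> 0} \<union> {n. g n \<noteq> 0}"
  have "finite ?S" using assms by (simp add: fin_supp_def)
  then have "ip f g = (\<Sum>n\<in>?S. cnj (f n) * g n)" "ip g f = (\<Sum>n\<in>?S. cnj (g n) * f n)"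
    by (auto intro: ip_eq_sum)
  then show ?thesis by (simp add: mult.commute)
qed

lemma ip_self: "ip f f = complex_of_real (\<Sum>n | f n \<noteq> 0. (cmod (f n))\<^sup>2)"
  unfolding ip_def of_real_sum complex_norm_square by (simp add: mult.commute)

lemma Re_ip_self_nonneg: "0 \<le> Re (ip f f)"
  unfolding ip_self by (simp add: sum_nonneg)

lemma norm_le_ip_self:
  assumes "fin_supp f"
  shows "(cmod (f n))\<^sup>2 \<le> Re (ip f f)"
  using assms unfolding ip_self fin_supp_def
  by (cases "f n = 0") (auto intro!: sum_nonneg member_le_sum)

text \<open>The bound \<open>1 / 2\<close> on both diagonals makes \<open>D\<close> a contraction, so that \<open>H = D\<^sup>* D\<close> and \<open>T = 1 - H\<close> lie between 0 and 1.\<close>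

locale bidiagonal =
  fixes \<alpha> \<beta> :: "int \<Rightarrow> complex"
  assumes \<alpha>_le: "cmod (\<alpha> n) \<le> 1 / 2" and \<beta>_le: "cmod (\<beta> n) \<le> 1 / 2"
begin

definition D :: "(int \<Rightarrow> complex) \<Rightarrow> int \<Rightarrow> complex" where
  "D f n = \<alpha> n * f n + \<beta> n * f (n - 1)"

definition D_adj :: "(int \<Rightarrow> complex) \<Rightarrow> int \<Rightarrow> complex" where
  "D_adj f n = cnj (\<alpha> n) * f n + cnj (\<beta> (n + 1)) * f (n + 1)"

definition H :: "(int \<Rightarrow> complex) \<Rightarrow> int \<Rightarrow> complex" where
  "H f = D_adj (D f)"

definition T :: "(int \<Rightarrow> complex) \<Rightarrow> int \<Rightarrow> complex" where
  "T f n = f n - H f n"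

lemma finite_shift: "finite {n :: int. f n \<noteq> (0 :: complex)} \<Longrightarrow> finite {n. f (n + c) \<noteq> 0}"
  using finite_vimageI[of "{n. f n \<noteq> 0}" "\<lambda>n. n + c"] by (simp add: vimage_def inj_def)

lemma fin_supp_D: "fin_supp f \<Longrightarrow> fin_supp (D f)"
  unfolding fin_supp_def
  by (rule finite_subset[of _ "{n. f n \<noteq> 0} \<union> {n. f (n + - 1) \<noteq> 0}"])
     (auto simp: D_def intro: finite_shift[of f "-1", simplified])

lemma fin_supp_D_adj: "fin_supp f \<Longrightarrow> fin_supp (D_adj f)"
  unfolding fin_supp_def
  by (rule finite_subset[of _ "{n. f n \<noteq> 0} \<union> {n. f (n + 1) \<noteq> 0}"])
     (auto simp: D_adj_def intro: finite_shift)

lemma fin_supp_H [simp]: "fin_supp f \<Longrightarrow> fin_supp (H f)"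
  by (simp add: H_def fin_supp_D fin_supp_D_adj)

lemma fin_supp_T [simp]: "fin_supp f \<Longrightarrow> fin_supp (T f)"
  using fin_supp_H[of f] unfolding fin_supp_def
  by (rule rev_finite_subset[OF finite_UnI]) (auto simp: T_def)

lemma fin_supp_H_pow [simp]: "fin_supp f \<Longrightarrow> fin_supp ((H ^^ k) f)"
  by (induction k) auto

lemma fin_supp_T_pow [simp]: "fin_supp f \<Longrightarrow> fin_supp ((T ^^ k) f)"
  by (induction k) auto

lemma ip_D:
  assumes "fin_supp f"
  shows "ip (D f) g = ip f (D_adj g)"
proof -
  let ?A = "{n. f n \<noteq> 0}" and ?B = "{n. f (n - 1) \<noteq> 0}"
  have fin: "finite ?A" "finite ?B"
    using assms finite_shift[of f "-1"] by (auto simp: fin_supp_def)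
  have "ip (D f) g = (\<Sum>n\<in>?A \<union> ?B. cnj (D f n) * g n)"
    using fin by (intro ip_eq_sum) (auto simp: D_def)
  also have "\<dots> = (\<Sum>n\<in>?A \<union> ?B. cnj (\<alpha> n) * cnj (f n) * g n)
      + (\<Sum>n\<in>?A \<union> ?B. cnj (\<beta> n) * cnj (f (n - 1)) * g n)"
    by (simp add: D_def sum.distrib[symmetric] algebra_simps)
  also have "(\<Sum>n\<in>?A \<union> ?B. cnj (\<alpha> n) * cnj (f n) * g n) = (\<Sum>n\<in>?A. cnj (\<alpha> n) * cnj (f n) * g n)"
    using fin by (intro sum.mono_neutral_right) auto
  also have "(\<Sum>n\<in>?A \<union> ?B. cnj (\<beta> n) * cnj (f (n - 1)) * g n) = (\<Sum>n\<in>?B. cnj (\<beta> n) * cnj (f (n - 1)) * g n)"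
    using fin by (intro sum.mono_neutral_right) auto
  also have "\<dots> = (\<Sum>n\<in>?A. cnj (\<beta> (n + 1)) * cnj (f n) * g (n + 1))"
    by (rule sum.reindex_bij_witness[of _ "\<lambda>n. n + 1" "\<lambda>n. n - 1"]) auto
  finally show ?thesis
    by (simp add: ip_def D_adj_def sum.distrib[symmetric] algebra_simps)
qed

lemma ip_H:
  assumes "fin_supp f" "fin_supp g"
  shows "ip (H f) g = ip (D f) (D g)" "ip f (H g) = ip (D f) (D g)"
proof -
  have *: "ip f (H g) = ip (D f) (D g)" if "fin_supp f" "fin_supp g" for f g
    using that by (simp add: H_def ip_D)
  then show "ip f (H g) = ip (D f) (D g)" using assms by simp
  have "ip (H f) g = cnj (ip g (H f))"
    using assms by (intro ip_commute) auto
  also have "\<dots> = cnj (ip (D g) (D f))" using *[of g f] assms by simp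
  also have "\<dots> = ip (D f) (D g)"
    using assms by (intro ip_commute[symmetric] fin_supp_D)
  finally show "ip (H f) g = ip (D f) (D g)" .
qed

lemma ip_H_swap: "fin_supp f \<Longrightarrow> fin_supp g \<Longrightarrow> ip (H f) g = ip f (H g)"
  by (simp add: ip_H)

lemma ip_T_swap:
  assumes "fin_supp f" "fin_supp g"
  shows "ip (T f) g = ip f (T g)"
proof -
  have *: "ip f (T g) = ip f g - ip f (H g)" for f g
    unfolding T_def by (rule ip_diff_right)
  have "ip (T f) g = cnj (ip g (T f))"
    using assms by (intro ip_commute) auto
  also have "\<dots> = cnj (ip g f) - cnj (ip g (H f))" by (simp add: *)
  also have "\<dots> = ip f g - ip (H f) g"
    using assms ip_commute[of g f] ip_commute[of g "H f"] by simp
  finally show ?thesis using assms by (simp add: * ip_H_swap)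
qed

lemma ip_T_pow_swap:
  assumes "fin_supp f" "fin_supp g"
  shows "ip ((T ^^ m) f) g = ip f ((T ^^ m) g)"
  using assms
proof (induction m arbitrary: g)
  case (Suc m)
  have "ip ((T ^^ Suc m) f) g = ip ((T ^^ m) f) (T g)"
    using Suc.prems by (simp add: ip_T_swap)
  also have "\<dots> = ip f ((T ^^ m) (T g))"
    using Suc.prems by (intro Suc.IH) auto
  finally show ?case by (simp add: funpow_swap1)
qed simp

lemma D_contraction:
  assumes "fin_supp f"
  shows "Re (ip (D f) (D f)) \<le> Re (ip f f)"
proof -
  let ?A = "{n. f n \<noteq> 0}" and ?B = "{n. f (n - 1) \<noteq> 0}"
  have fin: "finite ?A" "finite ?B"
    using assms finite_shift[of f "-1"] by (auto simp: fin_supp_def)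
  have bound: "(cmod (D f n))\<^sup>2 \<le> ((cmod (f n))\<^sup>2 + (cmod (f (n - 1)))\<^sup>2) / 2" for n
  proof -
    have "cmod (D f n) \<le> cmod (\<alpha> n) * cmod (f n) + cmod (\<beta> n) * cmod (f (n - 1))"
      unfolding D_def by (metis norm_mult norm_triangle_ineq)
    also have "\<dots> \<le> 1 / 2 * cmod (f n) + 1 / 2 * cmod (f (n - 1))"
      by (intro add_mono mult_right_mono \<alpha>_le \<beta>_le) auto
    finally have "(cmod (D f n))\<^sup>2 \<le> ((cmod (f n) + cmod (f (n - 1))) / 2)\<^sup>2"
      by (intro power_mono) auto
    also have "\<dots> \<le> ((cmod (f n))\<^sup>2 + (cmod (f (n - 1)))\<^sup>2) / 2"
      using sum_squares_bound[of "cmod (f n)" "cmod (f (n - 1))"] by (simp add: power2_eq_square algebra_simps)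
    finally show ?thesis .
  qed
  have self: "Re (ip g g) = (\<Sum>n\<in>?A \<union> ?B. (cmod (g n))\<^sup>2)" if "\<And>n. n \<notin> ?A \<union> ?B \<Longrightarrow> g n = 0" for g
    unfolding ip_self using fin that by (simp, intro sum.mono_neutral_left) auto
  have "Re (ip (D f) (D f)) = (\<Sum>n\<in>?A \<union> ?B. (cmod (D f n))\<^sup>2)"
    by (rule self) (auto simp: D_def)
  also have "\<dots> \<le> (\<Sum>n\<in>?A \<union> ?B. ((cmod (f n))\<^sup>2 + (cmod (f (n - 1)))\<^sup>2) / 2)"
    by (intro sum_mono bound)
  also have "\<dots> = ((\<Sum>n\<in>?A \<union> ?B. (cmod (f n))\<^sup>2) + (\<Sum>n\<in>?A \<union> ?B. (cmod (f (n - 1)))\<^sup>2)) / 2"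
    by (simp flip: sum.distrib sum_divide_distrib)
  also have "(\<Sum>n\<in>?A \<union> ?B. (cmod (f n))\<^sup>2) = Re (ip f f)"
    by (rule self[symmetric]) auto
  also have "(\<Sum>n\<in>?A \<union> ?B. (cmod (f (n - 1)))\<^sup>2) = (\<Sum>n\<in>?B. (cmod (f (n - 1)))\<^sup>2)"
    using fin by (intro sum.mono_neutral_right) auto
  also have "\<dots> = (\<Sum>n\<in>?A. (cmod (f n))\<^sup>2)"
    by (rule sum.reindex_bij_witness[of _ "\<lambda>n. n + 1" "\<lambda>n. n - 1"]) auto
  also have "\<dots> = Re (ip f f)" by (simp add: ip_self)
  finally show ?thesis by simp
qed

text \<open>The quadratic form of \<open>H\<^sup>k (1 - H)\<^sup>j\<close>.\<close>

definition q :: "nat \<Rightarrow> nat \<Rightarrow> (int \<Rightarrow> complex) \<Rightarrow> real" where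
  "q k j f = Re (ip f ((H ^^ k) ((T ^^ j) f)))"

lemma H_diff: "H (\<lambda>n. f n - g n) = (\<lambda>n. H f n - H g n)"
  by (simp add: H_def D_def D_adj_def algebra_simps fun_eq_iff)

lemma H_pow_diff: "(H ^^ k) (\<lambda>n. f n - g n) = (\<lambda>n. (H ^^ k) f n - (H ^^ k) g n)"
  by (induction k) (simp_all add: H_diff)

lemma T_H_commute: "T (H f) = H (T f)"
  unfolding T_def[abs_def] by (simp add: H_diff)

lemma T_pow_H_commute: "(T ^^ j) (H f) = H ((T ^^ j) f)"
  by (induction j) (simp_all add: T_H_commute)

lemma q_split: "q k j f = q (Suc k) j f + q k (Suc j) f"
proof -
  have "(H ^^ k) ((T ^^ Suc j) f) = (\<lambda>n. (H ^^ k) ((T ^^ j) f) n - (H ^^ Suc k) ((T ^^ j) f) n)"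
    by (simp add: T_def[abs_def] H_pow_diff funpow_swap1)
  then show ?thesis
    unfolding q_def by (simp only: ip_diff_right) simp
qed

lemma q_Suc_Suc_left: "fin_supp f \<Longrightarrow> q (Suc (Suc k)) j f = q k j (H f)"
  unfolding q_def by (simp add: T_pow_H_commute ip_H_swap funpow_swap1)

lemma H_pow_T_commute: "(H ^^ k) (T f) = T ((H ^^ k) f)"
  by (induction k) (simp_all add: T_H_commute)

lemma q_Suc_Suc_right: "fin_supp f \<Longrightarrow> q k (Suc (Suc j)) f = q k j (T f)"
  unfolding q_def by (simp add: H_pow_T_commute[symmetric] ip_T_swap funpow_swap1)

text \<open>Pairs of factors \<open>H\<close> or of factors \<open>T\<close> move symmetrically to both arguments of the inner product, which leaves exponents at most 1.
The only remaining mixed case is reduced by \<open>H T = H T (T + H) = T H T + H T H\<close>.\<close>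

lemma q_nonneg: "fin_supp f \<Longrightarrow> q k j f \<ge> 0"
proof (induction "k + j" arbitrary: k j f rule: less_induct)
  case less
  have base: "q 0 0 f \<ge> 0" "q 1 0 f \<ge> 0" "q 0 1 f \<ge> 0" if "fin_supp f" for f
  proof -
    show "q 0 0 f \<ge> 0" "q 1 0 f \<ge> 0"
      using that by (simp_all add: q_def Re_ip_self_nonneg ip_H)
    then show "q 0 1 f \<ge> 0"
      using that D_contraction[of f] q_split[of 0 0 f] by (simp add: q_def ip_H)
  qed
  consider k' where "k = Suc (Suc k')" | j' where "j = Suc (Suc j')" | "k \<le> 1" "j \<le> 1"
    by (metis One_nat_def not0_implies_Suc not_less_eq_eq le_0_eq nat_le_linear)
  then show ?case
  proof cases
    case 1
    then show ?thesis using less by (simp add: q_Suc_Suc_left)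
  next
    case 2
    then show ?thesis using less by (simp add: q_Suc_Suc_right)
  next
    case 3
    have "q 1 1 f = q 0 1 (H f) + q 1 0 (T f)"
      using q_split[of 1 1 f] q_Suc_Suc_left[of f 0 1] q_Suc_Suc_right[of f 1 0] less.prems
      by simp
    then have "q 1 1 f \<ge> 0" using base less.prems by simp
    with 3 base less.prems show ?thesis
      by (cases k; cases j) auto
  qed
qed

lemma q_antimono_right: "fin_supp f \<Longrightarrow> q k (Suc j) f \<le> q k j f"
  using q_split[of k j f] q_nonneg[of f "Suc k" j] by simp

lemma q_le_0_right: "fin_supp f \<Longrightarrow> q k j f \<le> q k 0 f"
  by (induction j) (auto intro: order.trans[OF q_antimono_right])

text \<open>This is \<open>1 - m * x \<le> (1 - x)\<^sup>m\<close> on the unit interval, applied to \<open>H\<close>.\<close>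

lemma q_lower_bound:
  assumes "fin_supp f"
  shows "Re (ip f f) - m * Re (ip (D f) (D f)) \<le> q 0 m f"
proof (induction m)
  case 0
  then show ?case by (simp add: q_def)
next
  case (Suc m)
  have "q 1 m f \<le> Re (ip (D f) (D f))"
    using q_le_0_right[OF assms, of 1 m] assms by (simp add: q_def ip_H)
  then show ?case using Suc q_split[of 0 m f] by (simp add: algebra_simps)
qed

definition t :: "nat \<Rightarrow> int \<Rightarrow> int \<Rightarrow> complex" where
  "t m i j = (T ^^ m) (unit_vec j) i"

lemma t_hermitian: "t m j i = cnj (t m i j)"
proof -
  have "t m j i = ip (unit_vec j) ((T ^^ m) (unit_vec i))" by (simp add: t_def)
  also have "\<dots> = ip ((T ^^ m) (unit_vec j)) (unit_vec i)" by (simp add: ip_T_pow_swap)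
  also have "\<dots> = cnj (ip (unit_vec i) ((T ^^ m) (unit_vec j)))" by (intro ip_commute) auto
  finally show ?thesis by (simp add: t_def)
qed

lemma t_diag: "Re (t m i i) = q 0 m (unit_vec i)"
  by (simp add: t_def q_def)

lemma T_sum:
  assumes "finite I"
  shows "T (\<lambda>n. \<Sum>j\<in>I. c j * u j n) = (\<lambda>n. \<Sum>j\<in>I. c j * T (u j) n)"
  by (simp add: T_def H_def D_def D_adj_def fun_eq_iff sum_distrib_left sum.distrib sum_subtractf algebra_simps)

lemma T_pow_sum:
  assumes "finite I"
  shows "(T ^^ m) (\<lambda>n. \<Sum>j\<in>I. c j * u j n) = (\<lambda>n. \<Sum>j\<in>I. c j * (T ^^ m) (u j) n)"
  by (induction m) (simp_all add: T_sum[OF assms])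

lemma ip_T_pow:
  assumes I: "finite I" "\<And>n. n \<notin> I \<Longrightarrow> f n = 0"
  shows "ip f ((T ^^ m) f) = (\<Sum>i\<in>I. \<Sum>j\<in>I. cnj (f i) * t m i j * f j)"
proof -
  have "f = (\<lambda>n. \<Sum>j\<in>I. f j * unit_vec j n)"
  proof
    fix n show "f n = (\<Sum>j\<in>I. f j * unit_vec j n)"
      using I by (cases "n \<in> I") (auto simp: unit_vec_def sum.delta' if_distrib cong: if_cong)
  qed
  then have "(T ^^ m) f = (\<lambda>n. \<Sum>j\<in>I. f j * t m n j)"
    unfolding t_def using T_pow_sum[OF I(1), of m f unit_vec] by simp
  then show ?thesis using ip_eq_sum[where f = f and g = "(T ^^ m) f", OF I]
    by (simp add: sum_distrib_left mult_ac)
qed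

lemma Re_cnj_mult_mult: "Re (cnj a * x * a) = (cmod a)\<^sup>2 * Re x"
  unfolding cmod_power2 by (simp add: power2_eq_square algebra_simps)

lemma q_two_point:
  assumes "i \<noteq> j"
  shows "q 0 m (\<lambda>n. if n = i then a else if n = j then b else 0)
    = (cmod a)\<^sup>2 * Re (t m i i) + (cmod b)\<^sup>2 * Re (t m j j) + 2 * Re (cnj a * t m i j * b)"
    (is "q 0 m ?f = _")
proof -
  have "q 0 m ?f
    = Re (cnj a * t m i i * a) + Re (cnj b * t m j j * b) + Re (cnj a * t m i j * b) + Re (cnj b * t m j i * a)"
    unfolding q_def using assms ip_T_pow[of "{i, j}" ?f m] by (simp del: complex_cnj_cnj)
  also have "Re (cnj b * t m j i * a) = Re (cnj a * t m i j * b)"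
    unfolding t_hermitian[of m j i] by (simp add: algebra_simps)
  finally show ?thesis unfolding Re_cnj_mult_mult by simp
qed

lemma fin_supp_two_point [simp]: "fin_supp (\<lambda>n. if n = i then a else if n = j then b else 0)"
  unfolding fin_supp_def by (rule finite_subset[of _ "{i, j}"]) auto

text \<open>Positivity on vectors with two entries bounds each off-diagonal term by the mean of two diagonal ones.\<close>

lemma q_le_weighted_diag:
  assumes I: "finite I" "\<And>n. n \<notin> I \<Longrightarrow> f n = 0"
  shows "q 0 m f \<le> card I * (\<Sum>i\<in>I. (cmod (f i))\<^sup>2 * Re (t m i i))"
proof -
  let ?w = "\<lambda>i. (cmod (f i))\<^sup>2 * Re (t m i i)"
  have entry: "Re (cnj (f i) * t m i j * f j) \<le> (?w i + ?w j) / 2" for i j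
  proof (cases "i = j")
    case True
    then show ?thesis unfolding True Re_cnj_mult_mult by simp
  next
    case False
    have "0 \<le> q 0 m (\<lambda>n. if n = i then f i else if n = j then - f j else 0)"
      by (intro q_nonneg fin_supp_two_point)
    then show ?thesis unfolding q_two_point[OF False] by simp
  qed
  have "q 0 m f = (\<Sum>i\<in>I. \<Sum>j\<in>I. Re (cnj (f i) * t m i j * f j))"
    unfolding q_def using ip_T_pow[where f = f, OF I, of m] by simp
  also have "\<dots> \<le> (\<Sum>i\<in>I. \<Sum>j\<in>I. (?w i + ?w j) / 2)"
    by (intro sum_mono entry)
  also have "\<dots> = card I * (\<Sum>i\<in>I. ?w i)"
    by (simp add: sum.distrib add_divide_distrib sum_divide_distrib[symmetric] sum_distrib_left[symmetric])
  finally show ?thesis .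
qed

text \<open>A finitely supported approximate zero mode of \<open>D\<close> forces the diagonal of \<open>(1 - H)\<^sup>m\<close> to be large somewhere on its support, as long as
\<open>m\<close> stays below the inverse of \<open>\<parallel>D f\<parallel>\<^sup>2\<close>. Only diagonal entries appear because these are what can be averaged over all fibres.\<close>

lemma quasimode_bound:
  fixes C :: real
  assumes I: "finite I" "\<And>n. n \<notin> I \<Longrightarrow> f n = 0"
    and f0: "f 0 = 1" and C: "\<And>n. n \<in> I \<Longrightarrow> (cmod (f n))\<^sup>2 \<le> C"
    and m: "m * Re (ip (D f) (D f)) \<le> 1 / 2"
  shows "1 / 2 \<le> real (card I) * C * (\<Sum>i\<in>I. Re (t m i i))"
proof -
  have f: "fin_supp f"
    unfolding fin_supp_def by (rule finite_subset[OF _ I(1)]) (use I(2) in auto)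
  have "1 \<le> Re (ip f f)"
    using norm_le_ip_self[OF f, of 0] f0 by simp
  then have "1 / 2 \<le> q 0 m f"
    using q_lower_bound[OF f, of m] m by simp
  also have "\<dots> \<le> card I * (\<Sum>i\<in>I. (cmod (f i))\<^sup>2 * Re (t m i i))"
    by (rule q_le_weighted_diag[OF I])
  also have "\<dots> \<le> card I * (\<Sum>i\<in>I. C * Re (t m i i))"
    using C q_nonneg[of "unit_vec _" 0 m]
    by (intro mult_left_mono sum_mono mult_right_mono) (auto simp: t_diag)
  finally show ?thesis by (simp add: sum_distrib_left mult.assoc)
qed

lemma convergent_q: "fin_supp f \<Longrightarrow> convergent (\<lambda>m. q k m f)"
  by (rule Bseq_monoseq_convergent)
     (auto intro!: decseq_bounded[of _ 0] decseq_SucI q_antimono_right q_nonneg simp: monoseq_Suc)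

text \<open>Quadratic forms of \<open>(1 - H)\<^sup>m\<close> decrease in \<open>m\<close>; polarisation gives the off-diagonal entries.\<close>

lemma convergent_t: "convergent (\<lambda>m. t m i j)"
proof (cases "i = j")
  case True
  have "t m i i = complex_of_real (q 0 m (unit_vec i))" for m
    using t_hermitian[of m i i] t_diag[of m i] by (simp add: complex_eq_iff)
  then show ?thesis
    using convergent_q[of "unit_vec i" 0] True by (simp add: convergent_of_real)
next
  case False
  have *: "convergent (\<lambda>m. Re (t m i j * b))" for b
  proof -
    let ?u = "\<lambda>n. if n = i then 1 else if n = j then b else 0"
    have eq: "(\<lambda>m. Re (t m i j * b)) =
      (\<lambda>m. 1 / 2 * (q 0 m ?u - q 0 m (unit_vec i) - (cmod b)\<^sup>2 * q 0 m (unit_vec j)))"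
      by (simp add: q_two_point[OF False] t_diag diff_divide_distrib)
    have "convergent (\<lambda>m. 1 / 2 * (q 0 m ?u - q 0 m (unit_vec i) - (cmod b)\<^sup>2 * q 0 m (unit_vec j)))"
      by (intro convergent_diff convergent_mult convergent_const convergent_q) auto
    then show ?thesis unfolding eq .
  qed
  from *[of 1] *[of "- \<i>"] obtain L L' where "(\<lambda>m. Re (t m i j)) \<longlonglongrightarrow> L" "(\<lambda>m. Im (t m i j)) \<longlonglongrightarrow> L'"
    by (auto simp: convergent_def)
  then have "(\<lambda>m. t m i j) \<longlonglongrightarrow> Complex L L'"
    by (simp add: tendsto_complex_iff)
  then show ?thesis by (auto simp: convergent_def)
qed

text \<open>The matrix of the orthogonal projection onto the kernel of \<open>H\<close>, as the limit of \<open>(1 - H)\<^sup>m\<close>.\<close>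

definition P :: "int \<Rightarrow> int \<Rightarrow> complex" where
  "P i j = lim (\<lambda>m. t m i j)"

lemma t_tendsto: "(\<lambda>m. t m i j) \<longlonglongrightarrow> P i j"
  unfolding P_def using convergent_t by (simp add: convergent_LIMSEQ_iff)

lemma P_hermitian: "P j i = cnj (P i j)"
  by (rule LIMSEQ_unique[OF t_tendsto]) (subst t_hermitian, intro tendsto_cnj t_tendsto)

text \<open>For \<open>u = (1 - H)\<^sup>m \<delta>\<^sub>j\<close> one has \<open>\<parallel>D u\<parallel>\<^sup>2 = \<langle>\<delta>\<^sub>j, H (1 - H)^(2 * m) \<delta>\<^sub>j\<rangle>\<close>, a difference of consecutive terms of a convergent sequence.\<close>

lemma P_kernel: "\<alpha> n * P n j + \<beta> n * P (n - 1) j = 0"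
proof -
  let ?u = "\<lambda>m. (T ^^ m) (unit_vec j)"
  have "(\<lambda>m. (cmod (D (?u m) n))\<^sup>2) \<longlonglongrightarrow> 0"
  proof (rule tendsto_sandwich[OF always_eventually always_eventually tendsto_const])
    show "\<forall>m. 0 \<le> (cmod (D (?u m) n))\<^sup>2" by simp
    have "(cmod (D (?u m) n))\<^sup>2 \<le> q 0 (2 * m) (unit_vec j) - q 0 (Suc (2 * m)) (unit_vec j)" for m
    proof -
      have "(cmod (D (?u m) n))\<^sup>2 \<le> Re (ip (D (?u m)) (D (?u m)))"
        by (intro norm_le_ip_self fin_supp_D fin_supp_T_pow fin_supp_unit_vec)
      also have "\<dots> = Re (ip (?u m) (H (?u m)))" by (simp add: ip_H)
      also have "\<dots> = Re (ip (unit_vec j) ((T ^^ m) (H (?u m))))"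
        by (subst ip_T_pow_swap) simp_all
      also have "\<dots> = q 1 (2 * m) (unit_vec j)"
        by (simp add: q_def T_pow_H_commute mult_2 funpow_add del: ip_unit_vec)
      finally show ?thesis using q_split[of 0 "2 * m"] by simp
    qed
    then show "\<forall>m. (cmod (D (?u m) n))\<^sup>2 \<le> q 0 (2 * m) (unit_vec j) - q 0 (Suc (2 * m)) (unit_vec j)" ..
    obtain l where l: "(\<lambda>m. q 0 m (unit_vec j)) \<longlonglongrightarrow> l"
      using convergent_q[of "unit_vec j" 0] by (auto simp: convergent_def)
    have "(\<lambda>m. q 0 (2 * m) (unit_vec j)) \<longlonglongrightarrow> l" "(\<lambda>m. q 0 (Suc (2 * m)) (unit_vec j)) \<longlonglongrightarrow> l"
      using LIMSEQ_subseq_LIMSEQ[OF l, of "\<lambda>m. 2 * m"] LIMSEQ_subseq_LIMSEQ[OF l, of "\<lambda>m. Suc (2 * m)"]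
      by (simp_all add: o_def strict_mono_def)
    from tendsto_diff[OF this]
    show "(\<lambda>m. q 0 (2 * m) (unit_vec j) - q 0 (Suc (2 * m)) (unit_vec j)) \<longlonglongrightarrow> 0" by simp
  qed
  from tendsto_real_sqrt[OF this] have "(\<lambda>m. D (?u m) n) \<longlonglongrightarrow> 0"
    by (simp add: tendsto_norm_zero_iff)
  moreover have "(\<lambda>m. D (?u m) n) \<longlonglongrightarrow> \<alpha> n * P n j + \<beta> n * P (n - 1) j"
    unfolding D_def t_def[symmetric] by (intro tendsto_intros t_tendsto)
  ultimately show ?thesis by (rule LIMSEQ_unique[symmetric])
qed

lemma P_diag_tendsto: "(\<lambda>m. Re (t m i i)) \<longlonglongrightarrow> Re (P i i)"
  by (intro tendsto_Re t_tendsto)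

text \<open>The columns solve the first order recursion \<open>D f = 0\<close> and the matrix is Hermitian, so \<open>P i j = w * v i * cnj (v j)\<close> for a single solution
\<open>v\<close>. Testing \<open>P \<le> 1\<close> on the truncation of \<open>v\<close> itself gives \<open>w * \<parallel>v\<parallel>\<^sup>2 \<le> 1\<close>, and the left-hand side is the trace.\<close>

lemma P_trace_le_1:
  assumes nz: "\<And>n. \<alpha> n \<noteq> 0"
  shows "(\<Sum>j<N. Re (P (int j) (int j))) \<le> 1"
proof (cases "N = 0")
  case False
  define v where "v k = (\<Prod>i<k. - \<beta> (int i + 1) / \<alpha> (int i + 1))" for k
  have step: "P (int k + 1) j = - \<beta> (int k + 1) / \<alpha> (int k + 1) * P (int k) j" for k j
    using P_kernel[of "int k + 1" j] nz[of "int k + 1"] by (simp add: field_simps add_eq_0_iff)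
  have col: "P (int k) j = v k * P 0 j" for k j
  proof (induction k)
    case (Suc k)
    have "P (int (Suc k)) j = P (int k + 1) j" by (simp add: add.commute)
    also have "\<dots> = v (Suc k) * P 0 j" unfolding step Suc by (simp add: v_def)
    finally show ?case .
  qed (simp add: v_def)
  define w where "w = Re (P 0 0)"
  have w: "P 0 0 = complex_of_real w"
    using P_hermitian[of 0 0] by (simp add: complex_eq_iff w_def)
  have rank1: "P (int k) (int l) = v k * cnj (v l) * w" for k l
    by (subst col, subst P_hermitian, subst col) (simp add: w)
  \<comment> \<open>the squared norm of the truncated solution\<close>
  define S where "S = (\<Sum>j<N. (cmod (v j))\<^sup>2)"
  have "S \<ge> (cmod (v 0))\<^sup>2" unfolding S_def
    using False by (intro member_le_sum) auto
  then have S: "S \<ge> 1" by (simp add: v_def)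
  define f where "f n = (if 0 \<le> n \<and> n < int N then v (nat n) else 0)" for n
  let ?I = "int ` {..<N}"
  have I: "finite ?I" "\<And>n. n \<notin> ?I \<Longrightarrow> f n = 0"
    by (auto simp: f_def image_iff) (metis lessThan_iff nat_less_iff int_nat_eq)
  have f: "fin_supp f" unfolding fin_supp_def by (rule finite_subset[OF _ I(1)]) (use I(2) in auto)
  have fv: "f (int k) = v k" if "k < N" for k using that by (simp add: f_def)
  have ipf: "Re (ip f f) = S"
  proof -
    have "ip f f = (\<Sum>n\<in>?I. cnj (f n) * f n)" by (rule ip_eq_sum[OF I])
    also have "\<dots> = (\<Sum>k<N. cnj (v k) * v k)" by (subst sum.reindex) (auto simp: fv)
    also have "\<dots> = complex_of_real S"
      unfolding S_def of_real_sum complex_norm_square by (simp add: mult.commute)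
    finally show ?thesis by simp
  qed
  have "(\<lambda>m. q 0 m f) \<longlonglongrightarrow> S * S * w"
  proof -
    have "(\<lambda>m. Re (\<Sum>i\<in>?I. \<Sum>j\<in>?I. cnj (f i) * t m i j * f j))
        \<longlonglongrightarrow> Re (\<Sum>i\<in>?I. \<Sum>j\<in>?I. cnj (f i) * P i j * f j)"
      by (intro tendsto_intros t_tendsto)
    also have "(\<lambda>m. Re (\<Sum>i\<in>?I. \<Sum>j\<in>?I. cnj (f i) * t m i j * f j)) = (\<lambda>m. q 0 m f)"
      unfolding q_def using ip_T_pow[where f = f, OF I] by simp
    also have "(\<Sum>i\<in>?I. \<Sum>j\<in>?I. cnj (f i) * P i j * f j)
        = (\<Sum>k<N. \<Sum>l<N. (cnj (v k) * v k) * (cnj (v l) * v l) * w)"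
      by (simp add: sum.reindex fv rank1 mult_ac)
    also have "\<dots> = complex_of_real S * complex_of_real S * w"
      unfolding S_def of_real_sum complex_norm_square
      by (simp add: sum_distrib_left sum_distrib_right mult_ac)
    finally show ?thesis by simp
  qed
  moreover have "q 0 m f \<le> S" for m
    using q_le_0_right[OF f, of 0 m] ipf by (simp add: q_def)
  ultimately have "S * S * w \<le> S" using LIMSEQ_le_const2 by blast
  then have "S * w \<le> 1" using S by (simp add: mult.assoc)
  also have "S * w = (\<Sum>j<N. Re (P (int j) (int j)))"
  proof -
    have "Re (P (int j) (int j)) = (cmod (v j))\<^sup>2 * w" for j
      unfolding rank1 complex_norm_square[symmetric] by (simp flip: of_real_mult of_real_power)
    then show ?thesis by (simp add: S_def sum_distrib_right)
  qed
  finally show ?thesis .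
qed simp

end

section \<open>Gaussian zero modes\<close>

context bidiagonal begin

text \<open>The two hypotheses on \<open>\<alpha>\<close> and \<open>\<beta>\<close> make the products of quotients that solve \<open>D f = 0\<close> to the right and to the left of 0 decay like
\<open>\<rho>^(- n^2)\<close>, up to a factor \<open>\<rho>^(2 * n)\<close> on the left. The truncated solution fails \<open>D f = 0\<close> only at the two ends.\<close>

lemma passage_quasimode:
  fixes \<rho> :: real and K m :: nat
  assumes \<rho>: "\<rho> \<ge> 5"
    and fwd: "\<And>n. 1 \<le> n \<Longrightarrow> n \<le> K \<Longrightarrow> \<alpha> (int n) \<noteq> 0 \<and> cmod (\<beta> (int n)) * \<rho> ^ (2 * n) \<le> 5 * cmod (\<alpha> (int n))"
    and bwd: "\<And>n. n \<le> K \<Longrightarrow> \<beta> (- int n) \<noteq> 0 \<and> cmod (\<alpha> (- int n)) * \<rho> ^ (2 * n) \<le> 5 * cmod (\<beta> (- int n))"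
    and m: "real m * \<rho> ^ (4 * K) \<le> \<rho> ^ (2 * K\<^sup>2)"
  shows "1 / 2 \<le> real (2 * K + 1) * \<rho>\<^sup>2 * (\<Sum>i\<in>{- int K..int K}. Re (t m i i))"
proof -
  \<comment> \<open>the solution of \<open>D f = 0\<close> with value 1 at 0, to the right and to the left\<close>
  define p where "p n = (\<Prod>i<n. - \<beta> (int (Suc i)) / \<alpha> (int (Suc i)))" for n
  define r where "r n = (\<Prod>i<n. - \<alpha> (- int i) / \<beta> (- int i))" for n
  define f where "f n = (if \<bar>n\<bar> > int K then 0 else if n \<ge> 0 then p (nat n) else r (nat (- n)))" for n
  have \<rho>0: "\<rho> > 0" "\<rho> \<ge> 1" using \<rho> by auto
  have p: "cmod (p n) * \<rho> ^ (n\<^sup>2) \<le> 1" if "n \<le> K" for n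
    using that
  proof (induction n)
    case (Suc n)
    have "\<alpha> (int (Suc n)) \<noteq> 0" and "cmod (\<beta> (int (Suc n))) * \<rho> ^ (2 * Suc n) \<le> 5 * cmod (\<alpha> (int (Suc n)))"
      using fwd[of "Suc n"] Suc.prems by auto
    then have "cmod (\<beta> (int (Suc n))) / cmod (\<alpha> (int (Suc n))) * \<rho> ^ (2 * n + 1) * \<rho> \<le> 5"
      by (simp add: field_simps)
    also have "\<dots> \<le> 1 * \<rho>" using \<rho> by simp
    finally have *: "cmod (\<beta> (int (Suc n))) / cmod (\<alpha> (int (Suc n))) * \<rho> ^ (2 * n + 1) \<le> 1"
      using \<rho>0 by (simp only: mult_le_cancel_right_pos)
    have "(Suc n)\<^sup>2 = n\<^sup>2 + (2 * n + 1)" by (simp add: power2_eq_square)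
    then have "cmod (p (Suc n)) * \<rho> ^ ((Suc n)\<^sup>2) = (cmod (p n) * \<rho> ^ (n\<^sup>2)) *
      (cmod (\<beta> (int (Suc n))) / cmod (\<alpha> (int (Suc n))) * \<rho> ^ (2 * n + 1))"
      by (simp only: power_add) (simp add: p_def norm_mult norm_divide)
    also have "\<dots> \<le> 1 * 1"
      using Suc * \<rho>0 by (intro mult_mono) auto
    finally show ?case by simp
  qed (simp add: p_def)
  have r: "cmod (r n) * \<rho> ^ (n\<^sup>2) \<le> \<rho> ^ (2 * n)" if "n \<le> K" for n
    using that
  proof (induction n)
    case (Suc n)
    have "\<beta> (- int n) \<noteq> 0" and "cmod (\<alpha> (- int n)) * \<rho> ^ (2 * n) \<le> 5 * cmod (\<beta> (- int n))"
      using bwd[of n] Suc.prems by auto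
    then have "cmod (\<alpha> (- int n)) / cmod (\<beta> (- int n)) * \<rho> ^ (2 * n) \<le> 5"
      by (simp add: field_simps)
    also have "\<dots> \<le> \<rho>" using \<rho> by simp
    finally have "cmod (\<alpha> (- int n)) / cmod (\<beta> (- int n)) * \<rho> ^ (2 * n) * \<rho> \<le> \<rho> * \<rho>"
      using \<rho>0 by (intro mult_right_mono) auto
    then have *: "cmod (\<alpha> (- int n)) / cmod (\<beta> (- int n)) * \<rho> ^ (2 * n + 1) \<le> \<rho> ^ 2"
      by (simp add: power2_eq_square mult_ac)
    have "(Suc n)\<^sup>2 = n\<^sup>2 + (2 * n + 1)" by (simp add: power2_eq_square)
    then have "cmod (r (Suc n)) * \<rho> ^ ((Suc n)\<^sup>2) = (cmod (r n) * \<rho> ^ (n\<^sup>2)) *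
      (cmod (\<alpha> (- int n)) / cmod (\<beta> (- int n)) * \<rho> ^ (2 * n + 1))"
      by (simp only: power_add) (simp add: r_def norm_mult norm_divide)
    also have "\<dots> \<le> \<rho> ^ (2 * n) * \<rho> ^ 2"
      using Suc * \<rho>0 by (intro mult_mono) auto
    finally show ?case by (simp add: power_add power2_eq_square mult_ac)
  qed (simp add: r_def)
  have pow: "\<rho> ^ (2 * n) \<le> \<rho> * \<rho> ^ (n\<^sup>2)" for n
  proof -
    have "2 * n \<le> Suc (n\<^sup>2)"
      using zero_le_power2[of "int n - 1"] by (simp add: power2_eq_square algebra_simps flip: of_nat_mult)
    then have "\<rho> ^ (2 * n) \<le> \<rho> ^ Suc (n\<^sup>2)" using \<rho>0 by (intro power_increasing)
    then show ?thesis by simp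
  qed
  have f_le: "(cmod (f n))\<^sup>2 \<le> \<rho>\<^sup>2" for n
  proof -
    have "cmod (p k) \<le> \<rho>" if "k \<le> K" for k
    proof -
      have "cmod (p k) * 1 \<le> cmod (p k) * \<rho> ^ (k\<^sup>2)" using \<rho>0 by (intro mult_left_mono) auto
      with p[OF that] \<rho> show ?thesis by simp
    qed
    moreover have "cmod (r k) \<le> \<rho>" if "k \<le> K" for k
    proof -
      have "cmod (r k) * \<rho> ^ (k\<^sup>2) \<le> \<rho> * \<rho> ^ (k\<^sup>2)" using r[OF that] pow[of k] by linarith
      then show ?thesis using \<rho>0 by simp
    qed
    ultimately have "cmod (f n) \<le> \<rho>" using \<rho>0 by (auto simp: f_def)
    then show ?thesis by (intro power_mono) auto
  qed
  have D0: "D f n = 0" if n: "n \<noteq> - int K" "n \<noteq> int K + 1" for n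
  proof -
    consider "\<bar>n\<bar> > int K" "\<bar>n - 1\<bar> > int K" | "1 \<le> n" "n \<le> int K" | "- int K < n" "n \<le> 0"
      using n by linarith
    then show ?thesis
    proof cases
      case 1
      then show ?thesis by (simp add: D_def f_def)
    next
      case 2
      define k where "k = nat (n - 1)"
      have k: "n = int (Suc k)" "Suc k \<le> K" using 2 by (auto simp: k_def)
      have "nat n = Suc k" "nat (n - 1) = k" using k by auto
      then have "f n = p (Suc k)" "f (n - 1) = p k"
        using k by (auto simp: f_def)
      moreover have "\<alpha> n \<noteq> 0" using fwd[of "Suc k"] k by simp
      ultimately show ?thesis unfolding D_def by (simp add: p_def k(1))
    next
      case 3
      define k where "k = nat (- n)"
      have k: "n = - int k" "Suc k \<le> K" using 3 by (auto simp: k_def)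
      have "f n = r k"
        using k by (cases "k = 0") (auto simp: f_def r_def p_def)
      moreover have "nat (1 - n) = Suc k" using k by simp
      then have "f (n - 1) = r (Suc k)"
        using k by (auto simp: f_def)
      moreover have "\<beta> n \<noteq> 0" using bwd[of k] k by simp
      ultimately show ?thesis unfolding D_def by (simp add: r_def k(1))
    qed
  qed
  have "Re (ip (D f) (D f)) = (cmod (D f (- int K)))\<^sup>2 + (cmod (D f (int K + 1)))\<^sup>2"
  proof -
    have "ip (D f) (D f) = (\<Sum>n\<in>{- int K, int K + 1}. cnj (D f n) * D f n)"
      using D0 by (intro ip_eq_sum) auto
    then have "ip (D f) (D f) = complex_of_real ((cmod (D f (- int K)))\<^sup>2 + (cmod (D f (int K + 1)))\<^sup>2)"
      unfolding of_real_add complex_norm_square by (simp add: mult.commute)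
    then show ?thesis by simp
  qed
  also have "D f (- int K) = \<alpha> (- int K) * r K"
    by (cases "K = 0") (auto simp: D_def f_def r_def p_def)
  also have "D f (int K + 1) = \<beta> (int K + 1) * p K"
    by (simp add: D_def f_def)
  also have "(cmod (\<alpha> (- int K) * r K))\<^sup>2 + (cmod (\<beta> (int K + 1) * p K))\<^sup>2 \<le>
     (1 / 2 * cmod (r K))\<^sup>2 + (1 / 2 * cmod (p K))\<^sup>2"
    unfolding norm_mult by (intro add_mono power_mono mult_right_mono \<alpha>_le \<beta>_le) auto
  finally have Df: "Re (ip (D f) (D f)) \<le> ((cmod (r K))\<^sup>2 + (cmod (p K))\<^sup>2) / 4"
    by (simp add: power_mult_distrib power_divide)
  have "(cmod (r K))\<^sup>2 * \<rho> ^ (2 * K\<^sup>2) \<le> \<rho> ^ (4 * K)"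
  proof -
    have "(cmod (r K) * \<rho> ^ (K\<^sup>2))\<^sup>2 \<le> (\<rho> ^ (2 * K))\<^sup>2" using r[of K] \<rho>0 by (intro power_mono) auto
    then show ?thesis by (simp add: power_mult_distrib power_mult[symmetric] mult.commute)
  qed
  moreover have "(cmod (p K))\<^sup>2 * \<rho> ^ (2 * K\<^sup>2) \<le> \<rho> ^ (4 * K)"
  proof -
    have "(cmod (p K) * \<rho> ^ (K\<^sup>2))\<^sup>2 \<le> 1\<^sup>2" using p[of K] \<rho>0 by (intro power_mono) auto
    then have "(cmod (p K))\<^sup>2 * \<rho> ^ (2 * K\<^sup>2) \<le> 1" by (simp add: power_mult_distrib power_mult[symmetric] mult.commute)
    also have "1 \<le> \<rho> ^ (4 * K)" using \<rho>0 by simp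
    finally show ?thesis .
  qed
  ultimately have "Re (ip (D f) (D f)) * \<rho> ^ (2 * K\<^sup>2) \<le> \<rho> ^ (4 * K) / 2"
    using mult_right_mono[OF Df, of "\<rho> ^ (2 * K\<^sup>2)"] \<rho>0 by (simp add: algebra_simps)
  then have "real m * (Re (ip (D f) (D f)) * \<rho> ^ (2 * K\<^sup>2)) \<le> real m * (\<rho> ^ (4 * K) / 2)"
    by (intro mult_left_mono) auto
  also have "\<dots> \<le> 1 / 2 * \<rho> ^ (2 * K\<^sup>2)" using m by simp
  finally have "real m * Re (ip (D f) (D f)) * \<rho> ^ (2 * K\<^sup>2) \<le> 1 / 2 * \<rho> ^ (2 * K\<^sup>2)"
    by (simp add: mult.assoc)
  then have "real m * Re (ip (D f) (D f)) \<le> 1 / 2"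
    using \<rho>0 by (simp only: mult_le_cancel_right_pos zero_less_power)
  then have "1 / 2 \<le> real (card {- int K..int K}) * \<rho>\<^sup>2 * (\<Sum>i\<in>{- int K..int K}. Re (t m i i))"
    using f_le by (intro quasimode_bound[where f = f]) (auto simp: f_def p_def)
  moreover have "card {- int K..int K} = 2 * K + 1" by simp
  ultimately show ?thesis by (simp only:)
qed

end

section \<open>Convolution operators\<close>

lemma convolve_sum_of_deltas:
  assumes I: "finite I" and k: "k ` I \<subseteq> carrier G"
  shows "convolve G (\<lambda>z. \<Sum>i\<in>I. if k i = z then c i else 0) f z
       = (\<Sum>i\<in>I. c i * f (inv\<^bsub>G\<^esub> (k i) \<otimes>\<^bsub>G\<^esub> z))"
proof -
  let ?H = "\<lambda>z. \<Sum>i\<in>I. if k i = z then c i else 0"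
  have "?H h = 0" if "h \<notin> k ` I" for h
    using that by (intro sum.neutral) auto
  then have "convolve G ?H f z = (\<Sum>h\<in>k ` I. ?H h * f (inv\<^bsub>G\<^esub> h \<otimes>\<^bsub>G\<^esub> z))"
    unfolding convolve_def using I k by (intro sum.mono_neutral_left) auto
  also have "\<dots> = (\<Sum>h\<in>k ` I. \<Sum>i\<in>{i\<in>I. k i = h}. c i * f (inv\<^bsub>G\<^esub> (k i) \<otimes>\<^bsub>G\<^esub> z))"
    using I by (intro sum.cong refl) (simp add: sum_distrib_right sum.inter_filter if_distrib[of "\<lambda>x. x * _"] cong: if_cong)
  also have "\<dots> = (\<Sum>i\<in>I. c i * f (inv\<^bsub>G\<^esub> (k i) \<otimes>\<^bsub>G\<^esub> z))"
    using I by (intro sum.group) auto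
  finally show ?thesis .
qed

lemma (in group) convolve_right_translate:
  assumes "g \<in> carrier G" "z \<in> carrier G"
  shows "convolve G H f (z \<otimes> g) = convolve G H (\<lambda>z. f (z \<otimes> g)) z"
  unfolding convolve_def using assms by (intro sum.cong refl) (auto simp: m_assoc)

lemma convolve_cong:
  assumes "group G" "z \<in> carrier G" "\<And>z. z \<in> carrier G \<Longrightarrow> f z = f' z"
  shows "convolve G H f z = convolve G H f' z"
proof -
  interpret group G by fact
  show ?thesis unfolding convolve_def using assms by (intro sum.cong refl) auto
qed

text \<open>Left convolution commutes with right translation, so every point mass has the same return weights as the one at the identity.\<close>

lemma (in group) convolve_pow_delta_translate:
  assumes "g \<in> carrier G" "z \<in> carrier G"
  shows "(convolve G H ^^ k) (\<lambda>z. if z = g then 1 else 0) (z \<otimes> g) = (convolve G H ^^ k) (delta_one G) z"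
  using assms(2)
proof (induction k arbitrary: z)
  case 0
  then show ?case using assms(1) r_cancel_one[of g z] by (simp add: delta_one_def)
next
  case (Suc k)
  then show ?case
    using assms(1) by (simp add: convolve_right_translate) (rule convolve_cong[OF is_group])
qed

lemma (in group) ell2_inner_delta_one: "ell2_inner G (delta_one G) f = f \<one>"
proof -
  have "ell2_inner G (delta_one G) f = infsum (\<lambda>g. cnj (delta_one G g) * f g) {\<one>}"
    unfolding ell2_inner_def by (intro infsum_cong_neutral) (auto simp: delta_one_def)
  then show ?thesis by (simp add: delta_one_def)
qed

text \<open>The product \<open>D\<^sup>* D\<close> for \<open>D = (\<Sum>i\<in>I. d i * g i)\<close>, written as a sum of point masses.\<close>

definition gram_element :: "('a, 'b) monoid_scheme \<Rightarrow> 'i set \<Rightarrow> ('i \<Rightarrow> 'a) \<Rightarrow> ('i \<Rightarrow> real) \<Rightarrow> 'a \<Rightarrow> complex" where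
  "gram_element G I g d z =
     (\<Sum>p\<in>I \<times> I. if inv\<^bsub>G\<^esub> (g (fst p)) \<otimes>\<^bsub>G\<^esub> g (snd p) = z then complex_of_real (d (fst p) * d (snd p)) else 0)"

lemma (in group) gram_element_random_walk:
  assumes I: "finite I" "I \<noteq> {}" and g: "\<And>i. i \<in> I \<Longrightarrow> g i \<in> carrier G" and d: "\<And>i. i \<in> I \<Longrightarrow> d i > 0"
  shows "corresponds_to_random_walk G (gram_element G I g d)"
proof -
  let ?H = "gram_element G I g d"
  have supp: "{z. ?H z \<noteq> 0} \<subseteq> (\<lambda>p. inv g (fst p) \<otimes> g (snd p)) ` (I \<times> I)"
  proof
    fix z assume "z \<in> {z. ?H z \<noteq> 0}"
    then have "(\<Sum>p\<in>I \<times> I. if inv g (fst p) \<otimes> g (snd p) = z then complex_of_real (d (fst p) * d (snd p)) else 0) \<noteq> 0"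
      by (simp add: gram_element_def)
    from sum.not_neutral_contains_not_neutral[OF this]
    show "z \<in> (\<lambda>p. inv g (fst p) \<otimes> g (snd p)) ` (I \<times> I)" by (metis (no_types, lifting) imageI)
  qed
  have alg: "?H \<in> group_algebra G"
    unfolding group_algebra_def using supp finite_subset[OF supp] I g by fastforce
  have sa: "self_adjoint G ?H"
    unfolding self_adjoint_def
  proof
    fix z assume z: "z \<in> carrier G"
    have "?H (inv z) = (\<Sum>p\<in>I \<times> I. if inv g (fst p) \<otimes> g (snd p) = inv z then complex_of_real (d (fst p) * d (snd p)) else 0)"
      by (simp add: gram_element_def)
    also have "\<dots> = (\<Sum>p\<in>I \<times> I. if inv g (fst p) \<otimes> g (snd p) = z then complex_of_real (d (fst p) * d (snd p)) else 0)"
    proof (rule sum.reindex_bij_witness[of _ prod.swap prod.swap])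
      fix p assume p: "p \<in> I \<times> I"
      have "inv (inv g (fst p) \<otimes> g (snd p)) = inv g (snd p) \<otimes> g (fst p)"
        using p g by (auto simp: inv_mult_group)
      then have "inv g (fst p) \<otimes> g (snd p) = inv z \<longleftrightarrow> inv g (snd p) \<otimes> g (fst p) = z"
        using p g z by (metis SigmaE fst_conv inv_closed inv_inv m_closed snd_conv)
      then show "(if inv g (fst (prod.swap p)) \<otimes> g (snd (prod.swap p)) = z then complex_of_real (d (fst (prod.swap p)) * d (snd (prod.swap p))) else 0)
          = (if inv g (fst p) \<otimes> g (snd p) = inv z then complex_of_real (d (fst p) * d (snd p)) else 0)"
        by (simp add: mult.commute)
    qed auto
    also have "\<dots> = cnj (?H z)" by (simp add: gram_element_def if_distrib cong: if_cong)
    finally show "?H (inv z) = cnj (?H z)" .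
  qed
  have real: "?H z = complex_of_real (\<Sum>p\<in>I \<times> I. if inv g (fst p) \<otimes> g (snd p) = z then d (fst p) * d (snd p) else 0)" for z
    unfolding gram_element_def of_real_sum by (intro sum.cong) auto
  have nonneg: "?H z \<in> \<real>\<^sub>\<ge>\<^sub>0" for z
    unfolding real nonneg_Reals_of_real_iff using d by (intro sum_nonneg) (auto simp: less_imp_le)
  obtain i where i: "i \<in> I" using I by auto
  have "0 < (\<Sum>p\<in>I \<times> I. if inv g (fst p) \<otimes> g (snd p) = \<one> then d (fst p) * d (snd p) else 0)"
    using I d g i by (intro sum_pos2[of _ "(i, i)"]) (auto simp: less_imp_le)
  then have "?H \<one> \<noteq> 0" unfolding real of_real_eq_0_iff by linarith
  then show ?thesis
    unfolding corresponds_to_random_walk_def using alg sa nonneg by blast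
qed

section \<open>The hyperbolic matrix and its group\<close>

definition hyp_mat :: "int ^ 2 ^ 2" where "hyp_mat = vector [vector [1, 2], vector [2, 5]]"

lemma det_hyp_mat: "det hyp_mat = 1"
  by (simp add: hyp_mat_def det_2)

lemma hyp_mat_mult: "(hyp_mat *v v) $ 1 = v $ 1 + 2 * v $ 2" "(hyp_mat *v v) $ 2 = 2 * v $ 1 + 5 * v $ 2"
  by (simp_all add: hyp_mat_def matrix_vector_mult_def sum_2)

text \<open>An eigenvalue satisfies \<open>l + 1 / l = 6\<close>, whereas \<open>1 / l = cnj l\<close> on the unit circle would make it at most 2.\<close>

lemma hyperbolic_hyp_mat: "hyperbolic_matrix hyp_mat"
  unfolding hyperbolic_matrix_def
proof (intro allI impI notI)
  fix l :: complex and v :: "complex ^ 2"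
  assume "v \<noteq> 0 \<and> map_matrix of_int hyp_mat *v v = l *s v" and l: "cmod l = 1"
  then have v: "v \<noteq> 0" and ev: "map_matrix of_int hyp_mat *v v = l *s v" by auto
  have 1: "v $ 1 + 2 * v $ 2 = l * v $ 1" and 2: "2 * v $ 1 + 5 * v $ 2 = l * v $ 2"
    using arg_cong[OF ev, of "\<lambda>w. w $ 1"] arg_cong[OF ev, of "\<lambda>w. w $ 2"]
    by (simp_all add: hyp_mat_def matrix_vector_mult_def sum_2 map_matrix_def)
  have "(l * l - 6 * l + 1) * v $ 1 = 0" "(l * l - 6 * l + 1) * v $ 2 = 0"
    using 1 2 by algebra+
  with v have "l * l - 6 * l + 1 = 0" by (auto simp: vec_eq_iff forall_2)
  moreover have "l * cnj l = 1"
    using l complex_norm_square[of l] by simp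
  ultimately have "l + cnj l = 6" by algebra
  then have "Re l = 3" by (simp add: complex_eq_iff)
  with l abs_Re_le_cmod[of l] show False by simp
qed

abbreviation act :: "int \<Rightarrow> int ^ 2 \<Rightarrow> int ^ 2" where "act \<equiv> matrix_act hyp_mat"

lemmas act_add = matrix_act_add[OF det_hyp_mat] and act_plus = matrix_act_plus[OF det_hyp_mat]

lemma act_inverse [simp]: "act n (act (- n) v) = v" "act (- n) (act n v) = v"
  using act_add[of n "- n" v] act_add[of "- n" n v] by simp_all

lemma act_zero [simp]: "act n 0 = 0"
  using act_plus[of n 0 0] by simp

lemma act_uminus: "act n (- v) = - act n v"
  using act_plus[of n v "- v"] by (simp add: eq_neg_iff_add_eq_0 add.commute)

lemma act_Suc_right: "act (n + 1) v = act n (hyp_mat *v v)"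
  using act_add[of n 1 v] matrix_act_Suc[OF det_hyp_mat, of 0 v] by simp

abbreviation "Sol \<equiv> semidirect hyp_mat"

interpretation Sol: group Sol by (rule group_semidirect[OF det_hyp_mat])

lemma carrier_Sol [simp]: "carrier Sol = UNIV" by (simp add: semidirect_def)

lemma mult_Sol: "(v, n) \<otimes>\<^bsub>Sol\<^esub> (w, m) = (v + act n w, n + m)"
  by (simp add: semidirect_def)

lemma one_Sol: "\<one>\<^bsub>Sol\<^esub> = (0, 0)" by (simp add: semidirect_def)

lemma inv_Sol: "inv\<^bsub>Sol\<^esub> (v, n) = (- act (- n) v, - n)"
  by (rule Sol.inv_equality) (simp_all add: mult_Sol one_Sol)

section \<open>Fourier transform in the normal subgroup\<close>

definition pairing :: "int ^ 2 \<Rightarrow> real \<times> real \<Rightarrow> real" where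
  "pairing v y = real_of_int (v $ 1) * fst y + real_of_int (v $ 2) * snd y"

text \<open>The character of \<open>\<int>\<^sup>2\<close> at the half-integer point \<open>(1/2, 1/2)\<close>. It is invariant under the action because the matrix is the identity
modulo 2.\<close>

definition parity_sign :: "int ^ 2 \<Rightarrow> complex" where
  "parity_sign v = (if even (v $ 1 + v $ 2) then 1 else -1)"

lemma parity_sign_plus: "parity_sign (v + w) = parity_sign v * parity_sign w"
  by (auto simp: parity_sign_def)

lemma parity_sign_hyp_mat: "parity_sign (hyp_mat *v v) = parity_sign v"
  by (auto simp: parity_sign_def hyp_mat_mult)

lemma parity_sign_act: "parity_sign (act n v) = parity_sign v"
proof (induction n rule: int_induct[where k = 0])
  case (step1 i)
  then show ?case by (simp add: matrix_act_Suc[OF det_hyp_mat] parity_sign_hyp_mat)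
next
  case (step2 i)
  then show ?case using parity_sign_hyp_mat[of "act (i - 1) v"] matrix_act_Suc[OF det_hyp_mat, of "i - 1" v] by simp
qed simp

text \<open>The character at the point of the torus which the \<open>n\<close>-th inverse iterate produces from \<open>(1/2, 1/2) + y / (2 * pi)\<close>. The
matrix is applied to \<open>v\<close> instead of \<open>y\<close>, so that only its integer powers are needed.\<close>

definition twisted_char :: "real \<times> real \<Rightarrow> int \<Rightarrow> int ^ 2 \<Rightarrow> complex" where
  "twisted_char y n v = parity_sign v * cis (pairing (act (- n) v) y)"

lemma pairing_plus: "pairing (v + w) y = pairing v y + pairing w y"
  by (simp add: pairing_def algebra_simps)

lemma pairing_uminus: "pairing (- v) y = - pairing v y"
  by (simp add: pairing_def)

lemma twisted_char_plus: "twisted_char y n (v + w) = twisted_char y n v * twisted_char y n w"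
  by (simp add: twisted_char_def parity_sign_plus act_plus pairing_plus cis_mult[symmetric])

lemma twisted_char_uminus: "twisted_char y n (- v) = cnj (twisted_char y n v)"
  by (simp add: twisted_char_def parity_sign_def act_uminus pairing_uminus cis_cnj)

lemma twisted_char_act: "twisted_char y n (act m v) = twisted_char y (n - m) v"
  by (simp add: twisted_char_def parity_sign_act act_add[symmetric])

text \<open>Evaluating the coefficients on the level \<open>n\<close> at the \<open>n\<close>-th point of an orbit makes translations by the group act inside a single fibre
\<open>y\<close>: an element of \<open>\<int>\<^sup>2\<close> multiplies by its character along the orbit and the generator of \<open>\<int>\<close> shifts the level.\<close>

definition fourier :: "((int ^ 2) \<times> int \<Rightarrow> complex) \<Rightarrow> real \<times> real \<Rightarrow> int \<Rightarrow> complex" where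
  "fourier f y n = (\<Sum>v | f (v, n) \<noteq> 0. f (v, n) * twisted_char y n v)"

lemma finite_slice:
  assumes "finite {z. f z \<noteq> (0 :: complex)}"
  shows "finite {v. f (v, n) \<noteq> 0}"
  by (rule finite_subset[OF _ finite_imageI[OF assms, of fst]]) force

lemma fourier_eq_sum:
  assumes "finite S" "\<And>v. v \<notin> S \<Longrightarrow> f (v, n) = 0"
  shows "fourier f y n = (\<Sum>v\<in>S. f (v, n) * twisted_char y n v)"
  unfolding fourier_def using assms by (intro sum.mono_neutral_left) auto

lemma fourier_translate: "fourier (\<lambda>z. f (inv\<^bsub>Sol\<^esub> (w, m) \<otimes>\<^bsub>Sol\<^esub> z)) y n = twisted_char y n w * fourier f y (n - m)"
proof -
  have *: "inv\<^bsub>Sol\<^esub> (w, m) \<otimes>\<^bsub>Sol\<^esub> (v, n) = (act (- m) (v - w), n - m)" for v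
    using act_plus[of "- m" v "- w"] by (simp add: inv_Sol mult_Sol act_uminus)
  show ?thesis
    unfolding fourier_def * sum_distrib_left
  proof (rule sum.reindex_bij_witness[of _ "\<lambda>v. w + act m v" "\<lambda>v. act (- m) (v - w)"])
    fix v
    have "twisted_char y n v = twisted_char y n w * twisted_char y n (act m (act (- m) (v - w)))"
      by (simp flip: twisted_char_plus)
    also have "\<dots> = twisted_char y n w * twisted_char y (n - m) (act (- m) (v - w))"
      by (simp only: twisted_char_act)
    finally show "twisted_char y n w * (f (act (- m) (v - w), n - m) * twisted_char y (n - m) (act (- m) (v - w)))
        = f (act (- m) (v - w), n - m) * twisted_char y n v"
      by simp
  qed auto
qed

lemma fourier_sum:
  assumes I: "finite I" and f: "\<And>i. i \<in> I \<Longrightarrow> finite {z. f i z \<noteq> 0}"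
  shows "fourier (\<lambda>z. \<Sum>i\<in>I. c i * f i z) y n = (\<Sum>i\<in>I. c i * fourier (f i) y n)"
proof -
  define S where "S = (\<Union>i\<in>I. {v. f i (v, n) \<noteq> 0})"
  have S: "finite S" unfolding S_def using I f by (intro finite_UN_I finite_slice) auto
  have "fourier (\<lambda>z. \<Sum>i\<in>I. c i * f i z) y n = (\<Sum>v\<in>S. (\<Sum>i\<in>I. c i * f i (v, n)) * twisted_char y n v)"
    by (rule fourier_eq_sum[OF S]) (auto simp: S_def intro!: sum.neutral)
  also have "\<dots> = (\<Sum>i\<in>I. \<Sum>v\<in>S. c i * (f i (v, n) * twisted_char y n v))"
    unfolding sum_distrib_right by (subst sum.swap) (simp add: mult.assoc)
  also have "\<dots> = (\<Sum>i\<in>I. c i * fourier (f i) y n)"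
    unfolding sum_distrib_left[symmetric]
    by (intro sum.cong refl) (subst fourier_eq_sum[OF S], auto simp: S_def)
  finally show ?thesis .
qed

definition torus :: "(real \<times> real) set" where "torus = cbox (- pi, - pi) (pi, pi)"

lemma integral_cis:
  fixes k :: int
  shows "integral (cbox (- pi) pi) (\<lambda>x. cis (of_int k * x)) = (if k = 0 then 2 * pi else 0)"
proof (cases "k = 0")
  case False
  define F where "F x = cis (of_int k * x) / (\<i> * of_int k)" for x :: real
  have "((\<lambda>x. cis (of_int k * x)) has_integral (F pi - F (- pi))) {- pi..pi}"
  proof (rule fundamental_theorem_of_calculus)
    fix x
    show "(F has_vector_derivative cis (of_int k * x)) (at x within {- pi..pi})"
      unfolding F_def cis_conv_exp using False
      by (auto intro!: derivative_eq_intros has_vector_derivative_real_field simp: field_simps)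
  qed simp
  moreover have "F pi = F (- pi)"
  proof -
    have "cis (of_int k * pi) = cis (- (of_int k * pi))"
      by (simp add: complex_eq_iff sin_times_pi_eq_0)
    then show ?thesis by (simp add: F_def)
  qed
  ultimately show ?thesis using False by (simp add: integral_unique cbox_interval)
qed (simp add: scaleR_conv_of_real)

lemma continuous_on_twisted_char [continuous_intros]: "continuous_on S (\<lambda>y. twisted_char y n v)"
  unfolding twisted_char_def pairing_def cis_conv_exp by (intro continuous_intros)

lemma integral_twisted_char: "integral torus (\<lambda>y. twisted_char y n v) = (if v = 0 then 4 * pi\<^sup>2 else 0)"
proof -
  define w where "w = act (- n) v"
  have w: "w = 0 \<longleftrightarrow> v = 0" using act_inverse(1)[of n v] act_zero unfolding w_def by metis
  have "integral torus (\<lambda>y. twisted_char y n v) = integral torus (\<lambda>y. parity_sign v * cis (pairing w y))"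
    by (simp add: twisted_char_def w_def)
  also have "\<dots> = parity_sign v * integral torus (\<lambda>y. cis (pairing w y))" by simp
  also have "integral torus (\<lambda>y. cis (pairing w y)) =
     integral (cbox (- pi) pi) (\<lambda>s. integral (cbox (- pi) pi) (\<lambda>t. cis (pairing w (s, t))))"
    unfolding torus_def
    by (rule integral_prod_continuous) (auto simp: pairing_def cis_conv_exp intro!: continuous_intros)
  also have "(\<lambda>s. integral (cbox (- pi) pi) (\<lambda>t. cis (pairing w (s, t)))) =
     (\<lambda>s. cis (of_int (w $ 1) * s) * integral (cbox (- pi) pi) (\<lambda>t. cis (of_int (w $ 2) * t)))"
    by (simp add: pairing_def cis_mult[symmetric])
  also have "integral (cbox (- pi) pi) (\<lambda>s. cis (of_int (w $ 1) * s) * integral (cbox (- pi) pi) (\<lambda>t. cis (of_int (w $ 2) * t)))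
     = integral (cbox (- pi) pi) (\<lambda>s. cis (of_int (w $ 1) * s)) * integral (cbox (- pi) pi) (\<lambda>t. cis (of_int (w $ 2) * t))"
    by simp
  also have "\<dots> = (if w = 0 then 4 * pi\<^sup>2 else 0)"
    unfolding integral_cis by (auto simp: vec_eq_iff forall_2 power2_eq_square)
  finally show ?thesis unfolding w by (simp add: parity_sign_def)
qed

lemma integral_fourier:
  fixes f :: "(int ^ 2) \<times> int \<Rightarrow> complex"
  assumes "finite {z. f z \<noteq> 0}"
  shows "integral torus (\<lambda>y. fourier f y n) = 4 * pi\<^sup>2 * f (0, n)"
proof -
  have fin: "finite {v. f (v, n) \<noteq> 0}" by (rule finite_slice[OF assms])
  have "integral torus (\<lambda>y. fourier f y n) = (\<Sum>v | f (v, n) \<noteq> 0. integral torus (\<lambda>y. f (v, n) * twisted_char y n v))"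
    unfolding fourier_def torus_def
    by (intro integral_sum fin integrable_continuous continuous_intros)
  also have "\<dots> = (\<Sum>v | f (v, n) \<noteq> 0. if v = 0 then 4 * pi\<^sup>2 * f (v, n) else 0)"
    by (intro sum.cong refl) (simp add: integral_twisted_char)
  also have "\<dots> = 4 * pi\<^sup>2 * f (0, n)"
    using fin by (cases "f (0, n) = 0") (simp_all add: sum.delta')
  finally show ?thesis .
qed

section \<open>The random walk and its fibre operators\<close>

definition \<kappa> :: real where "\<kappa> = 1 + sqrt 2"

lemma \<kappa>_sq: "\<kappa>\<^sup>2 = 2 * \<kappa> + 1"
  by (simp add: \<kappa>_def power2_eq_square algebra_simps)

lemma \<kappa>_bounds: "2.4 < \<kappa>" "\<kappa> < 2.5"
proof -
  have "14 / 10 < sqrt 2" by (rule real_less_rsqrt) (simp add: power2_eq_square)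
  then show "2.4 < \<kappa>" by (simp add: \<kappa>_def)
  have "sqrt 2 < 15 / 10" by (rule real_less_lsqrt) (simp_all add: power2_eq_square)
  then show "\<kappa> < 2.5" by (simp add: \<kappa>_def)
qed

definition e1 :: "int ^ 2" where "e1 = vector [1, 0]"
definition e2 :: "int ^ 2" where "e2 = vector [0, 1]"

lemma e_components [simp]: "e1 $ 1 = 1" "e1 $ 2 = 0" "e2 $ 1 = 0" "e2 $ 2 = 1"
  by (simp_all add: e1_def e2_def)

text \<open>The six group elements of \<open>D = a + b t\<close>, the first three belonging to \<open>a\<close> and the last three to \<open>b t\<close>. At \<open>(1/2, 1/2)\<close> the
characters of \<open>e1\<close> and \<open>e2\<close> take the value \<open>-1\<close>, so the weighted characters cancel in \<open>a\<close> and in \<open>b\<close>. The inverse \<open>- e2\<close> in \<open>a\<close> turns the first order term \<open>\<kappa> * y1 + y2\<close> into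
\<open>\<kappa> * y1 - y2\<close>, which annihilates the eigenvector \<open>(1, \<kappa>)\<close>, while the term \<open>y1 + \<kappa> * y2\<close> of \<open>b\<close> annihilates \<open>(\<kappa>, -1)\<close>.\<close>

definition generator :: "nat \<Rightarrow> (int ^ 2) \<times> int" where
  "generator i = [(0, 0), (e1, 0), (- e2, 0), (0, 1), (e1, 1), (e2, 1)] ! i"

definition weight :: "nat \<Rightarrow> real" where
  "weight i = [\<kappa> + 1, \<kappa>, 1, \<kappa> + 1, 1, \<kappa>] ! i / (4 * (\<kappa> + 1))"

definition walk :: "(int ^ 2) \<times> int \<Rightarrow> complex" where
  "walk = gram_element Sol {..<6} generator weight"

lemma lessThan_6: "{..<6 :: nat} = {0, 1, 2, 3, 4, 5}"
  by auto

lemma walk_random_walk: "corresponds_to_random_walk Sol walk"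
  unfolding walk_def using \<kappa>_bounds
  by (intro Sol.gram_element_random_walk) (auto simp: weight_def lessThan_6)

definition fib_alpha :: "real \<times> real \<Rightarrow> int \<Rightarrow> complex" where
  "fib_alpha y n = (\<Sum>j\<in>{0, 1, 2}. weight j * twisted_char y n (fst (generator j)))"
definition fib_beta :: "real \<times> real \<Rightarrow> int \<Rightarrow> complex" where
  "fib_beta y n = (\<Sum>j\<in>{3, 4, 5}. weight j * twisted_char y n (fst (generator j)))"

lemma cmod_twisted_char [simp]: "cmod (twisted_char y n v) = 1"
  by (simp add: twisted_char_def norm_mult parity_sign_def)

lemma weight_sum: "(\<Sum>j\<in>{0, 1, 2}. weight j) = 1 / 2" "(\<Sum>j\<in>{3, 4, 5}. weight j) = 1 / 2"
  and weight_pos: "j < 6 \<Longrightarrow> weight j > 0"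
proof -
  have "\<kappa> + 1 > 0" using \<kappa>_bounds by simp
  then show "(\<Sum>j\<in>{0, 1, 2}. weight j) = 1 / 2" "(\<Sum>j\<in>{3, 4, 5}. weight j) = 1 / 2"
    by (simp_all add: weight_def add_divide_distrib[symmetric] divide_eq_eq)
  assume "j < 6"
  then have "j \<in> {0, 1, 2, 3, 4, 5}" using lessThan_6 by blast
  then show "weight j > 0" using \<kappa>_bounds by (auto simp: weight_def)
qed

lemma bidiagonal_fibre: "bidiagonal (fib_alpha y) (fib_beta y)"
proof
  fix n
  have "cmod (fib_alpha y n) \<le> (\<Sum>j\<in>{0, 1, 2}. cmod (weight j * twisted_char y n (fst (generator j))))"
    unfolding fib_alpha_def by (rule norm_sum)
  also have "\<dots> = (\<Sum>j\<in>{0, 1, 2}. weight j)"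
    using weight_pos[of 0] weight_pos[of 1] weight_pos[of 2] by (simp add: norm_mult)
  finally show "cmod (fib_alpha y n) \<le> 1 / 2" using weight_sum by simp
  have "cmod (fib_beta y n) \<le> (\<Sum>j\<in>{3, 4, 5}. cmod (weight j * twisted_char y n (fst (generator j))))"
    unfolding fib_beta_def by (rule norm_sum)
  also have "\<dots> = (\<Sum>j\<in>{3, 4, 5}. weight j)"
    using weight_pos[of 3] weight_pos[of 4] weight_pos[of 5] by (simp add: norm_mult)
  finally show "cmod (fib_beta y n) \<le> 1 / 2" using weight_sum by simp
qed

interpretation fib: bidiagonal "fib_alpha y" "fib_beta y" for y
  by (rule bidiagonal_fibre)

lemma convolve_walk:
  fixes f :: "(int ^ 2) \<times> int \<Rightarrow> complex"
  shows
  "convolve Sol walk f = (\<lambda>z. \<Sum>p\<in>{..<6} \<times> {..<6}. (weight (fst p) * weight (snd p)) *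
     f (inv\<^bsub>Sol\<^esub> (inv\<^bsub>Sol\<^esub> (generator (fst p)) \<otimes>\<^bsub>Sol\<^esub> generator (snd p)) \<otimes>\<^bsub>Sol\<^esub> z))"
  unfolding walk_def gram_element_def[abs_def]
  by (rule ext, subst convolve_sum_of_deltas) auto

lemma finite_support_translate:
  assumes "finite {z. f z \<noteq> (0 :: complex)}"
  shows "finite {z. f (a \<otimes>\<^bsub>Sol\<^esub> z) \<noteq> 0}"
proof -
  have "inj (\<lambda>z. a \<otimes>\<^bsub>Sol\<^esub> z)" by (rule injI) simp
  from finite_vimageI[OF assms this] show ?thesis by (simp add: vimage_def)
qed

lemma finite_support_convolve_walk:
  assumes "finite {z. f z \<noteq> 0}"
  shows "finite {z. convolve Sol walk f z \<noteq> 0}"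
proof (rule finite_subset)
  show "{z. convolve Sol walk f z \<noteq> 0} \<subseteq> (\<Union>p\<in>{..<6} \<times> {..<6}.
      {z. f (inv\<^bsub>Sol\<^esub> (inv\<^bsub>Sol\<^esub> (generator (fst p)) \<otimes>\<^bsub>Sol\<^esub> generator (snd p)) \<otimes>\<^bsub>Sol\<^esub> z) \<noteq> 0})" (is "_ \<subseteq> ?U")
  proof
    fix z assume "z \<in> {z. convolve Sol walk f z \<noteq> 0}"
    then have nz: "convolve Sol walk f z \<noteq> 0" by simp
    show "z \<in> ?U"
    proof (rule ccontr)
      assume "z \<notin> ?U"
      then have "convolve Sol walk f z = 0" unfolding convolve_walk by (intro sum.neutral) auto
      with nz show False ..
    qed
  qed
  show "finite ?U" by (intro finite_UN_I finite_support_translate assms) auto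
qed

lemma fourier_convolve_walk:
  assumes f: "finite {z. f z \<noteq> 0}"
  shows "fourier (convolve Sol walk f) y = fib.H y (fourier f y)"
proof
  fix n
  define F where "F = fourier f y"
  let ?w = "\<lambda>i. fst (generator i)" and ?m = "\<lambda>i. snd (generator i)"
  define DF where "DF n = (\<Sum>j<6. weight j * twisted_char y n (?w j) * F (n - ?m j))" for n
  have DF: "DF = fib.D y F"
    by (rule ext) (simp add: DF_def fib.D_def fib_alpha_def fib_beta_def lessThan_6 generator_def algebra_simps)
  have termwise: "fourier (\<lambda>z. f (inv\<^bsub>Sol\<^esub> (inv\<^bsub>Sol\<^esub> (generator i) \<otimes>\<^bsub>Sol\<^esub> generator j) \<otimes>\<^bsub>Sol\<^esub> z)) y n
     = cnj (twisted_char y (n + ?m i) (?w i)) * (twisted_char y (n + ?m i) (?w j) * F (n + ?m i - ?m j))" for i j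
  proof -
    have "inv\<^bsub>Sol\<^esub> (generator i) \<otimes>\<^bsub>Sol\<^esub> generator j = (act (- ?m i) (- ?w i + ?w j), - ?m i + ?m j)"
      by (cases "generator i"; cases "generator j") (simp add: inv_Sol mult_Sol act_plus act_uminus del: add_uminus_conv_diff uminus_add_conv_diff)
    then have "fourier (\<lambda>z. f (inv\<^bsub>Sol\<^esub> (inv\<^bsub>Sol\<^esub> (generator i) \<otimes>\<^bsub>Sol\<^esub> generator j) \<otimes>\<^bsub>Sol\<^esub> z)) y n
      = twisted_char y n (act (- ?m i) (- ?w i + ?w j)) * F (n - (- ?m i + ?m j))"
      unfolding F_def by (simp only: fourier_translate)
    also have "twisted_char y n (act (- ?m i) (- ?w i + ?w j)) = cnj (twisted_char y (n + ?m i) (?w i)) * twisted_char y (n + ?m i) (?w j)"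
      by (simp only: twisted_char_act twisted_char_plus twisted_char_uminus diff_minus_eq_add)
    also have "n - (- ?m i + ?m j) = n + ?m i - ?m j" by simp
    finally show ?thesis by (simp only: mult.assoc)
  qed
  have "fourier (convolve Sol walk f) y n = (\<Sum>p\<in>{..<6} \<times> {..<6}. (weight (fst p) * weight (snd p)) *
     fourier (\<lambda>z. f (inv\<^bsub>Sol\<^esub> (inv\<^bsub>Sol\<^esub> (generator (fst p)) \<otimes>\<^bsub>Sol\<^esub> generator (snd p)) \<otimes>\<^bsub>Sol\<^esub> z)) y n)"
    unfolding convolve_walk by (rule fourier_sum) (auto intro: finite_support_translate f)
  also have "\<dots> = (\<Sum>i<6. \<Sum>j<6. (weight i * weight j) * (cnj (twisted_char y (n + ?m i) (?w i)) * (twisted_char y (n + ?m i) (?w j) * F (n + ?m i - ?m j))))"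
    unfolding termwise by (simp add: sum.cartesian_product case_prod_unfold)
  also have "\<dots> = (\<Sum>i<6. weight i * cnj (twisted_char y (n + ?m i) (?w i)) * DF (n + ?m i))"
    by (simp add: DF_def sum_distrib_left mult_ac)
  also have "\<dots> = fib.D_adj y DF n"
    by (simp add: fib.D_adj_def fib_alpha_def fib_beta_def lessThan_6 generator_def algebra_simps)
  finally show "fourier (convolve Sol walk f) y n = fib.H y (fourier f y) n"
    by (simp add: fib.H_def DF F_def)
qed

lemma fourier_convolve_walk_pow:
  assumes "finite {z. f z \<noteq> 0}"
  shows "finite {z. (convolve Sol walk ^^ k) f z \<noteq> 0} \<and>
    fourier ((convolve Sol walk ^^ k) f) y = (fib.H y ^^ k) (fourier f y)"
  by (induction k) (auto simp: assms fourier_convolve_walk finite_support_convolve_walk)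

lemma twisted_char_0 [simp]: "twisted_char y n 0 = 1"
  by (simp add: twisted_char_def parity_sign_def pairing_def)

lemma fourier_delta: "fourier (\<lambda>z. if z = (0, j) then 1 else 0) y = unit_vec j"
proof
  fix n
  show "fourier (\<lambda>z. if z = (0, j) then 1 else 0) y n = unit_vec j n"
    by (subst fourier_eq_sum[of "{0}"]) (auto simp: unit_vec_def)
qed

definition moment :: "nat \<Rightarrow> real" where
  "moment k = Re ((convolve Sol walk ^^ k) (delta_one Sol) \<one>\<^bsub>Sol\<^esub>)"

lemma convolve_walk_Reals:
  assumes "\<And>z. f z \<in> \<real>"
  shows "convolve Sol walk f z \<in> \<real>"
  unfolding convolve_walk by (intro sum_in_Reals Reals_mult Reals_of_real assms)

lemma complex_of_real_moment: "complex_of_real (moment k) = ell2_inner Sol (delta_one Sol) ((convolve Sol walk ^^ k) (delta_one Sol))"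
proof -
  have "(convolve Sol walk ^^ k) (delta_one Sol) z \<in> \<real>" for z
    by (induction k arbitrary: z) (simp_all add: delta_one_def convolve_walk_Reals)
  then show ?thesis by (simp add: moment_def Sol.ell2_inner_delta_one)
qed

lemma integral_H_pow: "integral torus (\<lambda>y. (fib.H y ^^ k) (unit_vec j) j) = 4 * pi\<^sup>2 * complex_of_real (moment k)"
proof -
  let ?\<delta> = "\<lambda>z :: (int ^ 2) \<times> int. if z = (0, j) then 1 else 0 :: complex"
  have fin: "finite {z. ?\<delta> z \<noteq> 0}" by simp
  have "integral torus (\<lambda>y. (fib.H y ^^ k) (unit_vec j) j) = integral torus (\<lambda>y. fourier ((convolve Sol walk ^^ k) ?\<delta>) y j)"
    using fourier_convolve_walk_pow[OF fin] by (simp add: fourier_delta)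
  also have "\<dots> = 4 * pi\<^sup>2 * (convolve Sol walk ^^ k) ?\<delta> (0, j)"
    using fourier_convolve_walk_pow[OF fin] by (intro integral_fourier) blast
  also have "(convolve Sol walk ^^ k) ?\<delta> (0, j) = (convolve Sol walk ^^ k) (delta_one Sol) \<one>\<^bsub>Sol\<^esub>"
    using Sol.convolve_pow_delta_translate[where g = "(0, j)" and z = "\<one>\<^bsub>Sol\<^esub>" and H = walk and k = k] by simp
  also have "\<dots> = complex_of_real (moment k)"
    by (simp add: complex_of_real_moment Sol.ell2_inner_delta_one)
  finally show ?thesis .
qed

lemma continuous_on_fib_alpha [continuous_intros]: "continuous_on S (\<lambda>y. fib_alpha y n)"
  and continuous_on_fib_beta [continuous_intros]: "continuous_on S (\<lambda>y. fib_beta y n)"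
  unfolding fib_alpha_def fib_beta_def by (auto intro!: continuous_intros)

lemma continuous_on_fib_H:
  assumes "\<And>n. continuous_on S (\<lambda>y. f y n)"
  shows "continuous_on S (\<lambda>y. fib.H y (f y) n)"
  unfolding fib.H_def fib.D_adj_def fib.D_def by (intro continuous_intros assms)

lemma continuous_on_fib_H_pow:
  assumes "\<And>n. continuous_on S (\<lambda>y. f y n)"
  shows "continuous_on S (\<lambda>y. (fib.H y ^^ k) (f y) n)"
  by (induction k arbitrary: n) (auto simp: assms intro: continuous_on_fib_H)

lemma continuous_on_fib_T_pow:
  assumes "\<And>n. continuous_on S (\<lambda>y. f y n)"
  shows "continuous_on S (\<lambda>y. (fib.T y ^^ k) (f y) n)"
proof (induction k arbitrary: n)
  case (Suc k)
  then show ?case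
    by (simp add: fib.T_def) (intro continuous_intros continuous_on_fib_H)
qed (simp add: assms)

lemma continuous_on_fib_q: "continuous_on S (\<lambda>y. fib.q y k j (unit_vec n))"
  unfolding fib.q_def ip_unit_vec
  by (intro continuous_intros continuous_on_fib_H_pow continuous_on_fib_T_pow)

lemma integrable_fib_q: "(\<lambda>y. fib.q y k j (unit_vec n)) integrable_on torus"
  unfolding torus_def by (intro integrable_continuous continuous_on_fib_q)

lemma integral_fib_q_0: "integral torus (\<lambda>y. fib.q y k 0 (unit_vec n)) = 4 * pi\<^sup>2 * moment k"
proof -
  have "integral torus (\<lambda>y. fib.q y k 0 (unit_vec n)) = Re (integral torus (\<lambda>y. (fib.H y ^^ k) (unit_vec n) n))"
    unfolding fib.q_def ip_unit_vec torus_def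
    by (subst integral_linear[OF _ bounded_linear_Re, unfolded o_def, symmetric])
       (auto intro!: integrable_continuous continuous_on_fib_H_pow)
  then show ?thesis unfolding integral_H_pow by simp
qed

text \<open>The trace of \<open>H\<^sup>k (1 - H)\<^sup>j\<close>, which is going to be the integral of \<open>x\<^sup>k (1 - x)\<^sup>j\<close> against the spectral measure.\<close>

definition trace_moment :: "nat \<Rightarrow> nat \<Rightarrow> real" where
  "trace_moment k j = integral torus (\<lambda>y. fib.q y k j (unit_vec 0)) / (4 * pi\<^sup>2)"

text \<open>The diagonal entries at all sites \<open>n\<close> have the same average: this is translation invariance for \<open>j = 0\<close>, and the other cases are linear
combinations of it.\<close>

lemma integral_fib_q: "integral torus (\<lambda>y. fib.q y k j (unit_vec n)) = 4 * pi\<^sup>2 * trace_moment k j"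
proof -
  have "integral torus (\<lambda>y. fib.q y k j (unit_vec n)) = integral torus (\<lambda>y. fib.q y k j (unit_vec 0))"
  proof (induction j arbitrary: k)
    case 0
    show ?case by (simp only: integral_fib_q_0)
  next
    case (Suc j)
    have *: "integral torus (\<lambda>y. fib.q y k (Suc j) (unit_vec n)) =
       integral torus (\<lambda>y. fib.q y k j (unit_vec n)) - integral torus (\<lambda>y. fib.q y (Suc k) j (unit_vec n))" for n
      by (subst integral_diff[symmetric, OF integrable_fib_q integrable_fib_q])
         (simp add: fib.q_split[of _ k j])
    show ?case unfolding * by (simp add: Suc)
  qed
  then show ?thesis by (simp add: trace_moment_def)
qed

lemma trace_moment_nonneg: "trace_moment k j \<ge> 0"
  unfolding trace_moment_def by (intro divide_nonneg_nonneg integral_nonneg integrable_fib_q fib.q_nonneg) auto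

lemma trace_moment_split: "trace_moment k j = trace_moment (Suc k) j + trace_moment k (Suc j)"
proof -
  have "integral torus (\<lambda>y. fib.q y k j (unit_vec 0)) =
     integral torus (\<lambda>y. fib.q y (Suc k) j (unit_vec 0)) + integral torus (\<lambda>y. fib.q y k (Suc j) (unit_vec 0))"
    by (subst integral_add[symmetric, OF integrable_fib_q integrable_fib_q]) (simp add: fib.q_split[of _ k j])
  then show ?thesis by (simp add: trace_moment_def add_divide_distrib)
qed

lemma trace_moment_0_right: "trace_moment k 0 = moment k"
  by (simp add: trace_moment_def integral_fib_q_0)

section \<open>Passage near the common zero\<close>

lemma one_minus_cis_approx: "cmod ((1 - cis x) + \<i> * complex_of_real x) \<le> x\<^sup>2 / 2"
proof -
  have "cmod (iexp x - (\<Sum>k\<le>1. (\<i> * x) ^ k / fact k)) \<le> \<bar>x\<bar> ^ Suc 1 / fact (Suc 1)"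
    by (rule iexp_approx1)
  then show ?thesis
    by (simp add: cis_conv_exp[symmetric] power2_eq_square norm_minus_commute algebra_simps)
qed

text \<open>If \<open>a\<close> and \<open>b\<close> agree up to quadratic errors with \<open>-\<i> * N * s\<close> and \<open>-\<i> * N * u\<close>, and \<open>s\<close> dominates \<open>u\<close>, then the error is negligible
in \<open>a\<close>, whereas in \<open>b\<close> it may exceed the main term but costs only \<open>O(s)\<close> in the quotient.\<close>

lemma ratio_of_approximants:
  fixes a b :: complex and u s N \<kappa> :: real
  assumes a: "cmod (a + \<i> * complex_of_real (N * s)) \<le> \<kappa> * N * (u\<^sup>2 + s\<^sup>2) / 2"
    and b: "cmod (b + \<i> * complex_of_real (N * u)) \<le> \<kappa> * N * (u\<^sup>2 + s\<^sup>2) / 2"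
    and pos: "N > 0" "\<kappa> > 0" "0 < u" "u \<le> 2 * s" "5 * \<kappa> * s \<le> 1"
  shows "a \<noteq> 0 \<and> cmod b \<le> (2 * u / s + 5 * \<kappa> * s) * cmod a"
proof -
  have s: "s > 0" using pos by simp
  have "u\<^sup>2 \<le> (2 * s)\<^sup>2" using pos by (intro power_mono) auto
  then have sq: "u\<^sup>2 + s\<^sup>2 \<le> 5 * s\<^sup>2" by simp
  have err: "\<kappa> * N * (u\<^sup>2 + s\<^sup>2) / 2 \<le> \<kappa> * N * (5 * s\<^sup>2) / 2"
    using pos sq by (intro divide_right_mono mult_left_mono) auto
  have "N * s = cmod (\<i> * complex_of_real (N * s))" using pos s by (simp add: norm_mult)
  also have "\<dots> \<le> cmod (a + \<i> * complex_of_real (N * s)) + cmod a"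
    by (metis add.commute add_diff_cancel_left' norm_triangle_ineq4)
  also have "\<dots> \<le> \<kappa> * N * (5 * s\<^sup>2) / 2 + cmod a" using a err by linarith
  also have "\<kappa> * N * (5 * s\<^sup>2) / 2 = N * s / 2 * (5 * \<kappa> * s)" by (simp add: power2_eq_square)
  also have "\<dots> \<le> N * s / 2 * 1" using pos s by (intro mult_left_mono) auto
  finally have a_ge: "N * s / 2 \<le> cmod a" by simp
  have "cmod b \<le> cmod (b + \<i> * complex_of_real (N * u)) + cmod (\<i> * complex_of_real (N * u))"
    by (metis add_diff_cancel_right' norm_triangle_ineq4)
  also have "\<dots> \<le> \<kappa> * N * (5 * s\<^sup>2) / 2 + N * u"
  proof (intro add_mono)
    show "cmod (b + \<i> * complex_of_real (N * u)) \<le> \<kappa> * N * (5 * s\<^sup>2) / 2" using b err by linarith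
    show "cmod (\<i> * complex_of_real (N * u)) \<le> N * u" using pos by (simp add: norm_mult)
  qed
  also have "\<dots> = (2 * u / s + 5 * \<kappa> * s) * (N * s / 2)"
    using s by (simp add: field_simps power2_eq_square)
  also have "\<dots> \<le> (2 * u / s + 5 * \<kappa> * s) * cmod a"
    using pos s a_ge by (intro mult_left_mono) auto
  finally show ?thesis using a_ge pos s by (auto simp: mult_le_0_iff)
qed

text \<open>The coordinates of the \<open>n\<close>-th inverse iterate of \<open>y\<close>, read off from the action on characters.\<close>

definition theta1 :: "real \<times> real \<Rightarrow> int \<Rightarrow> real" where "theta1 y n = pairing (act (- n) e1) y"
definition theta2 :: "real \<times> real \<Rightarrow> int \<Rightarrow> real" where "theta2 y n = pairing (act (- n) e2) y"

lemma theta_0: "theta1 y 0 = fst y" "theta2 y 0 = snd y"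
  by (simp_all add: theta1_def theta2_def pairing_def)

lemma theta_step:
  "theta1 y n = theta1 y (n + 1) + 2 * theta2 y (n + 1)"
  "theta2 y n = 2 * theta1 y (n + 1) + 5 * theta2 y (n + 1)"
proof -
  have *: "act (- n) v = act (- (n + 1)) (hyp_mat *v v)" for v
    using act_Suc_right[of "- (n + 1)" v] by simp
  have 1: "hyp_mat *v e1 = e1 + (e2 + e2)" and 2: "hyp_mat *v e2 = (e1 + e1) + (e2 + e2 + e2 + e2 + e2)"
    by (simp_all add: vec_eq_iff forall_2 hyp_mat_mult)
  show "theta1 y n = theta1 y (n + 1) + 2 * theta2 y (n + 1)"
    unfolding theta1_def *[of e1] 1 by (simp only: theta2_def act_plus pairing_plus)
  show "theta2 y n = 2 * theta1 y (n + 1) + 5 * theta2 y (n + 1)"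
    unfolding theta2_def *[of e2] 2 by (simp only: theta1_def act_plus pairing_plus)
qed

text \<open>The coordinates of the same point in the basis of the eigenvectors \<open>(1, \<kappa>)\<close>, expanded by the matrix, and \<open>(\<kappa>, -1)\<close>, contracted by
it. Under inverse iteration the first shrinks and the second grows.\<close>

definition u_coord :: "real \<times> real \<Rightarrow> int \<Rightarrow> real" where "u_coord y n = (theta1 y n + \<kappa> * theta2 y n) / (2 * \<kappa> + 2)"
definition s_coord :: "real \<times> real \<Rightarrow> int \<Rightarrow> real" where "s_coord y n = (\<kappa> * theta1 y n - theta2 y n) / (2 * \<kappa> + 2)"

definition \<rho> :: real where "\<rho> = \<kappa>\<^sup>2"

lemma \<rho>_bounds: "5 \<le> \<rho>" "\<rho> \<le> 6" using \<kappa>_bounds unfolding \<rho>_def \<kappa>_sq by auto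

lemma u_coord_step: "u_coord y n = \<rho> * u_coord y (n + 1)"
proof -
  have "theta1 y n + \<kappa> * theta2 y n = \<kappa>\<^sup>2 * (theta1 y (n + 1) + \<kappa> * theta2 y (n + 1))"
    unfolding theta_step[of y n] using \<kappa>_sq by algebra
  then show ?thesis by (simp add: u_coord_def \<rho>_def)
qed

lemma s_coord_step: "s_coord y (n + 1) = \<rho> * s_coord y n"
proof -
  have "\<kappa> * theta1 y (n + 1) - theta2 y (n + 1) = \<kappa>\<^sup>2 * (\<kappa> * theta1 y n - theta2 y n)"
    unfolding theta_step[of y n] using \<kappa>_sq by algebra
  then show ?thesis by (simp add: s_coord_def \<rho>_def)
qed

lemma coord_forward:
  "u_coord y (int n) * (\<rho>) ^ n = u_coord y 0" "s_coord y (int n) = s_coord y 0 * (\<rho>) ^ n"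
proof (induction n)
  case (Suc n)
  {
    case 1
    show ?case using Suc.IH(1) u_coord_step[of y "int n"] by (simp add: mult_ac add.commute)
  next
    case 2
    show ?case using Suc.IH(2) s_coord_step[of y "int n"] by (simp add: mult_ac add.commute)
  }
qed auto

lemma coord_backward:
  "u_coord y (- int n) = u_coord y 0 * (\<rho>) ^ n" "s_coord y (- int n) * (\<rho>) ^ n = s_coord y 0"
proof (induction n)
  case (Suc n)
  {
    case 1
    show ?case using Suc.IH(1) u_coord_step[of y "- int (Suc n)"] by (simp add: mult_ac)
  next
    case 2
    show ?case using Suc.IH(2) s_coord_step[of y "- int (Suc n)"] by (simp add: mult_ac)
  }
qed auto

lemma parity_sign_e [simp]: "parity_sign e1 = - 1" "parity_sign e2 = - 1"
  by (simp_all add: parity_sign_def)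

lemma twisted_char_e: "twisted_char y n e1 = - cis (theta1 y n)" "twisted_char y n e2 = - cis (theta2 y n)" "twisted_char y n (- e2) = - cis (- theta2 y n)"
  unfolding twisted_char_uminus by (simp_all add: twisted_char_def theta1_def theta2_def cis_cnj)

definition wconst :: real where "wconst = 1 / (4 * (\<kappa> + 1))"

lemma wconst_pos: "wconst > 0" using \<kappa>_bounds by (simp add: wconst_def)

lemma fib_alpha_eq: "fib_alpha y n = wconst * (\<kappa> * (1 - cis (theta1 y n)) + (1 - cis (- theta2 y n)))"
  and fib_beta_eq: "fib_beta y n = wconst * ((1 - cis (theta1 y n)) + \<kappa> * (1 - cis (theta2 y n)))"
  by (simp_all add: fib_alpha_def fib_beta_def weight_def generator_def twisted_char_e wconst_def divide_inverse algebra_simps)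

text \<open>The eigenvectors are orthogonal, of squared length \<open>1 + \<kappa>\<^sup>2 = 2 * \<kappa> + 2\<close>.\<close>

lemma coord_norm: "(2 * \<kappa> + 2) * ((u_coord y n)\<^sup>2 + (s_coord y n)\<^sup>2) = (theta1 y n)\<^sup>2 + (theta2 y n)\<^sup>2"
proof -
  have N: "2 * \<kappa> + 2 \<noteq> 0" using \<kappa>_bounds by simp
  have "(theta1 y n + \<kappa> * theta2 y n)\<^sup>2 + (\<kappa> * theta1 y n - theta2 y n)\<^sup>2 = (2 * \<kappa> + 2) * ((theta1 y n)\<^sup>2 + (theta2 y n)\<^sup>2)"
    using \<kappa>_sq by algebra
  then have "(2 * \<kappa> + 2)\<^sup>2 * ((u_coord y n)\<^sup>2 + (s_coord y n)\<^sup>2) = (2 * \<kappa> + 2) * ((theta1 y n)\<^sup>2 + (theta2 y n)\<^sup>2)"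
    using N by (simp add: u_coord_def s_coord_def power_divide add_divide_distrib[symmetric])
  then show ?thesis using N by (simp add: power2_eq_square)
qed

lemma norm_scaled_add:
  fixes x y :: complex
  assumes "c \<ge> 0"
  shows "cmod (complex_of_real c * x + y) \<le> c * cmod x + cmod y"
  using norm_triangle_ineq[of "complex_of_real c * x" y] assms by (simp add: norm_mult)

lemma fib_alpha_approx: "cmod (complex_of_real (1 / wconst) * fib_alpha y n + \<i> * complex_of_real ((2 * \<kappa> + 2) * s_coord y n))
   \<le> \<kappa> * (2 * \<kappa> + 2) * ((u_coord y n)\<^sup>2 + (s_coord y n)\<^sup>2) / 2"
  and fib_beta_approx: "cmod (complex_of_real (1 / wconst) * fib_beta y n + \<i> * complex_of_real ((2 * \<kappa> + 2) * u_coord y n))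
   \<le> \<kappa> * (2 * \<kappa> + 2) * ((u_coord y n)\<^sup>2 + (s_coord y n)\<^sup>2) / 2"
proof -
  have N: "2 * \<kappa> + 2 \<noteq> 0" and \<kappa>: "\<kappa> \<ge> 1" using \<kappa>_bounds by auto
  let ?r = "\<lambda>x. (1 - cis x) + \<i> * complex_of_real x"
  have S: "(2 * \<kappa> + 2) * s_coord y n = \<kappa> * theta1 y n - theta2 y n" and U: "(2 * \<kappa> + 2) * u_coord y n = theta1 y n + \<kappa> * theta2 y n"
    using N by (simp_all add: s_coord_def u_coord_def)
  have "complex_of_real (1 / wconst) * fib_alpha y n + \<i> * complex_of_real ((2 * \<kappa> + 2) * s_coord y n)
      = \<kappa> * ?r (theta1 y n) + ?r (- theta2 y n)"
    using wconst_pos unfolding fib_alpha_eq S by (simp add: algebra_simps)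
  also have "cmod \<dots> \<le> \<kappa> * cmod (?r (theta1 y n)) + cmod (?r (- theta2 y n))"
    using \<kappa> by (intro norm_scaled_add) simp
  also have "\<dots> \<le> \<kappa> * ((theta1 y n)\<^sup>2 / 2) + 1 * ((- theta2 y n)\<^sup>2 / 2)"
    using \<kappa> one_minus_cis_approx[of "- theta2 y n"] by (intro add_mono mult_left_mono one_minus_cis_approx) auto
  also have "\<dots> \<le> \<kappa> * ((theta1 y n)\<^sup>2 / 2) + \<kappa> * ((- theta2 y n)\<^sup>2 / 2)"
    using \<kappa> by (intro add_mono mult_right_mono) auto
  also have "\<dots> = \<kappa> * (2 * \<kappa> + 2) * ((u_coord y n)\<^sup>2 + (s_coord y n)\<^sup>2) / 2"
    by (simp only: mult.assoc coord_norm) (simp add: distrib_left add_divide_distrib)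
  finally show "cmod (complex_of_real (1 / wconst) * fib_alpha y n + \<i> * complex_of_real ((2 * \<kappa> + 2) * s_coord y n))
    \<le> \<kappa> * (2 * \<kappa> + 2) * ((u_coord y n)\<^sup>2 + (s_coord y n)\<^sup>2) / 2" .
  have "complex_of_real (1 / wconst) * fib_beta y n + \<i> * complex_of_real ((2 * \<kappa> + 2) * u_coord y n)
      = ?r (theta1 y n) + \<kappa> * ?r (theta2 y n)"
    using wconst_pos unfolding fib_beta_eq U by (simp add: algebra_simps)
  also have "cmod \<dots> \<le> cmod (?r (theta1 y n)) + \<kappa> * cmod (?r (theta2 y n))"
    using \<kappa> norm_scaled_add[of \<kappa> "?r (theta2 y n)" "?r (theta1 y n)"] by (simp only: add.commute)
  also have "\<dots> \<le> 1 * ((theta1 y n)\<^sup>2 / 2) + \<kappa> * ((theta2 y n)\<^sup>2 / 2)"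
    using \<kappa> one_minus_cis_approx[of "theta1 y n"] by (intro add_mono mult_left_mono one_minus_cis_approx) auto
  also have "\<dots> \<le> \<kappa> * ((theta1 y n)\<^sup>2 / 2) + \<kappa> * ((theta2 y n)\<^sup>2 / 2)"
    using \<kappa> by (intro add_mono mult_right_mono) auto
  also have "\<dots> = \<kappa> * (2 * \<kappa> + 2) * ((u_coord y n)\<^sup>2 + (s_coord y n)\<^sup>2) / 2"
    by (simp only: mult.assoc coord_norm) (simp add: distrib_left add_divide_distrib)
  finally show "cmod (complex_of_real (1 / wconst) * fib_beta y n + \<i> * complex_of_real ((2 * \<kappa> + 2) * u_coord y n))
    \<le> \<kappa> * (2 * \<kappa> + 2) * ((u_coord y n)\<^sup>2 + (s_coord y n)\<^sup>2) / 2" .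
qed

lemma fib_alpha_dominates:
  assumes "0 < u_coord y n" "u_coord y n \<le> 2 * s_coord y n" "5 * \<kappa> * s_coord y n \<le> 1"
  shows "fib_alpha y n \<noteq> 0 \<and> cmod (fib_beta y n) \<le> (2 * u_coord y n / s_coord y n + 5 * \<kappa> * s_coord y n) * cmod (fib_alpha y n)"
proof -
  have "complex_of_real (1 / wconst) * fib_alpha y n \<noteq> 0 \<and> cmod (complex_of_real (1 / wconst) * fib_beta y n)
      \<le> (2 * u_coord y n / s_coord y n + 5 * \<kappa> * s_coord y n) * cmod (complex_of_real (1 / wconst) * fib_alpha y n)"
    by (rule ratio_of_approximants[OF fib_alpha_approx fib_beta_approx]) (use assms \<kappa>_bounds in auto)
  then show ?thesis using wconst_pos by (simp add: norm_mult norm_divide divide_right_mono field_simps)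
qed

lemma fib_beta_dominates:
  assumes "0 < s_coord y n" "s_coord y n \<le> 2 * u_coord y n" "5 * \<kappa> * u_coord y n \<le> 1"
  shows "fib_beta y n \<noteq> 0 \<and> cmod (fib_alpha y n) \<le> (2 * s_coord y n / u_coord y n + 5 * \<kappa> * u_coord y n) * cmod (fib_beta y n)"
proof -
  have "complex_of_real (1 / wconst) * fib_beta y n \<noteq> 0 \<and> cmod (complex_of_real (1 / wconst) * fib_alpha y n)
      \<le> (2 * s_coord y n / u_coord y n + 5 * \<kappa> * u_coord y n) * cmod (complex_of_real (1 / wconst) * fib_beta y n)"
    by (rule ratio_of_approximants[OF fib_beta_approx[unfolded add.commute[of "(u_coord y n)\<^sup>2" for y n]]
        fib_alpha_approx[unfolded add.commute[of "(u_coord y n)\<^sup>2" for y n]]])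
       (use assms \<kappa>_bounds in auto)
  then show ?thesis using wconst_pos by (simp add: norm_mult norm_divide divide_right_mono field_simps)
qed

text \<open>Along the orbit the decaying coordinate \<open>v\<close> and the growing coordinate \<open>w\<close> have quotient at most \<open>2 * \<rho>^(- 2 * n)\<close>, and the quadratic
error \<open>5 * \<kappa> * w\<close> is at most \<open>\<rho>^(- 2 * n)\<close> because \<open>w\<close> is at most \<open>\<delta> * \<rho>\<^sup>n\<close>; this is what fixes \<open>\<delta>\<close> as a multiple of
\<open>\<rho>^(- 3 * K)\<close>. It serves both time directions, with the two coordinates exchanged.\<close>

lemma passage_ratio:
  fixes \<rho> \<kappa> \<delta> u s v w :: real
  assumes \<rho>: "\<rho> \<ge> 1" and "\<kappa> > 0" and \<delta>: "5 * \<kappa> * \<delta> * \<rho> ^ (3 * K) = 1" and n: "n \<le> K"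
    and u: "\<delta> / 2 \<le> u" "u \<le> \<delta>" and s: "\<delta> / 2 \<le> s" "s \<le> \<delta>"
    and v: "v * \<rho> ^ n = u" and w: "w = s * \<rho> ^ n"
  shows "0 < v \<and> v \<le> 2 * w \<and> 5 * \<kappa> * w \<le> 1 \<and> (2 * v / w + 5 * \<kappa> * w) * \<rho> ^ (2 * n) \<le> 5"
proof -
  have \<delta>0: "\<delta> > 0"
  proof (rule ccontr)
    assume "\<not> \<delta> > 0"
    then have "5 * \<kappa> * \<delta> * \<rho> ^ (3 * K) \<le> 0"
      using \<rho> \<open>\<kappa> > 0\<close> by (intro mult_nonpos_nonneg mult_nonneg_nonpos) auto
    with \<delta> show False by simp
  qed
  have \<rho>n: "\<rho> ^ n \<ge> 1" using \<rho> by simp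
  have w0: "w > 0" using \<delta>0 s \<rho>n unfolding w by (intro mult_pos_pos) auto
  have "0 < v * \<rho> ^ n" using v u \<delta>0 by linarith
  then have v0: "v > 0" by (rule zero_less_mult_pos2) (use \<rho>n in simp)
  have "v * 1 \<le> v * \<rho> ^ n" using v0 \<rho>n by (intro mult_left_mono) auto
  also have "\<dots> \<le> 2 * s" using v u s by simp
  also have "\<dots> * 1 \<le> 2 * s * \<rho> ^ n" using s \<delta>0 \<rho>n by (intro mult_left_mono) auto
  finally have vw: "v \<le> 2 * w" by (simp add: w)
  have "5 * \<kappa> * w * \<rho> ^ (2 * n) = 5 * \<kappa> * s * \<rho> ^ (3 * n)"
    by (simp add: w power_add[symmetric])
  also have "\<dots> \<le> 5 * \<kappa> * \<delta> * \<rho> ^ (3 * K)"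
    using \<open>\<kappa> > 0\<close> s \<delta>0 n \<rho> by (intro mult_mono power_increasing) auto
  finally have 1: "5 * \<kappa> * w * \<rho> ^ (2 * n) \<le> 1" using \<delta> by simp
  have "5 * \<kappa> * w * 1 \<le> 5 * \<kappa> * w * \<rho> ^ (2 * n)"
    using \<open>\<kappa> > 0\<close> w0 \<rho> by (intro mult_left_mono) auto
  with 1 have 2: "5 * \<kappa> * w \<le> 1" by simp
  have "v / w * \<rho> ^ (2 * n) = (v * \<rho> ^ n) * \<rho> ^ n / (s * \<rho> ^ n)"
    by (simp add: w mult_2 power_add)
  also have "\<dots> = u / s" using v \<rho> by simp
  also have "\<dots> \<le> 2" using u s \<delta>0 by (simp add: divide_le_eq)
  finally have "2 * v / w * \<rho> ^ (2 * n) \<le> 4" by simp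
  with 1 have "(2 * v / w + 5 * \<kappa> * w) * \<rho> ^ (2 * n) \<le> 5" by (simp add: distrib_right)
  with v0 vw 2 show ?thesis by simp
qed

lemma fibre_lower_bound:
  assumes \<delta>: "5 * \<kappa> * \<delta> * \<rho> ^ (3 * K) = 1"
    and U: "\<delta> / 2 \<le> u_coord y 0" "u_coord y 0 \<le> \<delta>" and S: "\<delta> / 2 \<le> s_coord y 0" "s_coord y 0 \<le> \<delta>"
    and m: "real m * \<rho> ^ (4 * K) \<le> \<rho> ^ (2 * K\<^sup>2)"
  shows "1 / 2 \<le> real (2 * K + 1) * \<rho>\<^sup>2 * (\<Sum>i\<in>{- int K..int K}. fib.q y 0 m (unit_vec i))"
proof -
  have \<rho>: "\<rho> \<ge> 1" and \<kappa>: "\<kappa> > 0" using \<rho>_bounds \<kappa>_bounds by auto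
  have "1 / 2 \<le> real (2 * K + 1) * \<rho>\<^sup>2 * (\<Sum>i\<in>{- int K..int K}. Re (fib.t y m i i))"
  proof (rule fib.passage_quasimode[OF _ _ _ m])
    fix n assume "n \<le> K"
    note * = passage_ratio[OF \<rho> \<kappa> \<delta> this U S coord_forward]
    have "cmod (fib_beta y (int n)) * \<rho> ^ (2 * n) \<le> (2 * u_coord y (int n) / s_coord y (int n) + 5 * \<kappa> * s_coord y (int n)) * cmod (fib_alpha y (int n)) * \<rho> ^ (2 * n)"
      using fib_alpha_dominates[of y "int n"] * \<rho> by (intro mult_right_mono) auto
    also have "\<dots> = (2 * u_coord y (int n) / s_coord y (int n) + 5 * \<kappa> * s_coord y (int n)) * \<rho> ^ (2 * n) * cmod (fib_alpha y (int n))"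
      by (simp only: mult_ac)
    also have "\<dots> \<le> 5 * cmod (fib_alpha y (int n))" using * by (intro mult_right_mono) auto
    finally show "fib_alpha y (int n) \<noteq> 0 \<and> cmod (fib_beta y (int n)) * \<rho> ^ (2 * n) \<le> 5 * cmod (fib_alpha y (int n))"
      using fib_alpha_dominates[of y "int n"] * by blast
  next
    fix n assume "n \<le> K"
    note * = passage_ratio[OF \<rho> \<kappa> \<delta> this S U coord_backward(2,1)]
    have "cmod (fib_alpha y (- int n)) * \<rho> ^ (2 * n) \<le> (2 * s_coord y (- int n) / u_coord y (- int n) + 5 * \<kappa> * u_coord y (- int n)) * cmod (fib_beta y (- int n)) * \<rho> ^ (2 * n)"
      using fib_beta_dominates[of y "- int n"] * \<rho> by (intro mult_right_mono) auto
    also have "\<dots> = (2 * s_coord y (- int n) / u_coord y (- int n) + 5 * \<kappa> * u_coord y (- int n)) * \<rho> ^ (2 * n) * cmod (fib_beta y (- int n))"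
      by (simp only: mult_ac)
    also have "\<dots> \<le> 5 * cmod (fib_beta y (- int n))" using * by (intro mult_right_mono) auto
    finally show "fib_beta y (- int n) \<noteq> 0 \<and> cmod (fib_alpha y (- int n)) * \<rho> ^ (2 * n) \<le> 5 * cmod (fib_beta y (- int n))"
      using fib_beta_dominates[of y "- int n"] * by blast
  qed (use \<rho>_bounds in auto)
  then show ?thesis by (simp add: fib.t_diag)
qed

lemma odd_le_rho_power: "real (2 * K + 1) \<le> \<rho> ^ K"
proof (induction K)
  case (Suc K)
  have "real (2 * Suc K + 1) \<le> 5 * real (2 * K + 1)" by simp
  also have "\<dots> \<le> \<rho> * \<rho> ^ K" using Suc \<rho>_bounds by (intro mult_mono) auto
  finally show ?case by simp
qed simp

text \<open>Integrate the fibrewise bound over a square of side \<open>\<delta>\<close> around the point with both eigencoordinates \<open>3 / 4 * \<delta>\<close>, on which they stay between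
\<open>\<delta> / 2\<close> and \<open>\<delta>\<close>. All constants and the polynomial factor \<open>(2 * K + 1)\<^sup>2\<close> are absorbed into powers of \<open>\<rho>\<close>.\<close>

lemma trace_moment_lower_bound:
  assumes m: "real m * \<rho> ^ (4 * K) \<le> \<rho> ^ (2 * K\<^sup>2)"
  shows "1 / \<rho> ^ (8 * K + 8) \<le> trace_moment 0 m"
proof -
  define \<delta> where "\<delta> = 1 / (5 * \<kappa> * \<rho> ^ (3 * K))"
  have \<kappa>: "\<kappa> > 0" "\<rho> \<ge> 1" using \<kappa>_bounds \<rho>_bounds by auto
  have \<delta>: "5 * \<kappa> * \<delta> * \<rho> ^ (3 * K) = 1" using \<kappa> by (simp add: \<delta>_def)
  have "5 * 2 * 1 \<le> 5 * \<kappa> * \<rho> ^ (3 * K)"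
    using \<kappa>_bounds \<kappa> by (intro mult_mono) auto
  then have "1 / (5 * \<kappa> * \<rho> ^ (3 * K)) \<le> 1 / 10"
    by (intro divide_left_mono) auto
  then have \<delta>_bounds: "\<delta> > 0" "\<delta> \<le> 1 / 10"
    using \<kappa> unfolding \<delta>_def by auto
  define p1 p2 where "p1 = 3 / 4 * \<delta> * (1 + \<kappa>)" and "p2 = 3 / 4 * \<delta> * (\<kappa> - 1)"
  define B where "B = cbox (p1 - \<delta> / 2, p2 - \<delta> / 2) (p1 + \<delta> / 2, p2 + \<delta> / 2)"
  define g where "g y = real (2 * K + 1) * \<rho>\<^sup>2 * (\<Sum>i\<in>{- int K..int K}. fib.q y 0 m (unit_vec i))" for y
  have N: "2 * \<kappa> + 2 > 0" using \<kappa> by simp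
  have "p1 + \<kappa> * p2 = 3 / 4 * \<delta> * (1 + \<kappa>\<^sup>2)" "\<kappa> * p1 - p2 = 3 / 4 * \<delta> * (1 + \<kappa>\<^sup>2)"
  proof -
    have "c * (1 + \<kappa>) + \<kappa> * (c * (\<kappa> - 1)) = c * (1 + \<kappa>\<^sup>2)" "\<kappa> * (c * (1 + \<kappa>)) - c * (\<kappa> - 1) = c * (1 + \<kappa>\<^sup>2)" for c
      by (simp_all add: power2_eq_square algebra_simps)
    from this[of "3 / 4 * \<delta>"] show "p1 + \<kappa> * p2 = 3 / 4 * \<delta> * (1 + \<kappa>\<^sup>2)" "\<kappa> * p1 - p2 = 3 / 4 * \<delta> * (1 + \<kappa>\<^sup>2)"
      unfolding p1_def p2_def by simp_all
  qed
  then have p12: "p1 + \<kappa> * p2 = (2 * \<kappa> + 2) * (3 / 4 * \<delta>)" "\<kappa> * p1 - p2 = (2 * \<kappa> + 2) * (3 / 4 * \<delta>)"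
    unfolding \<kappa>_sq by simp_all
  have bound: "1 / 2 \<le> g y" if "y \<in> B" for y
  proof -
    define a b where "a = fst y - p1" and "b = snd y - p2"
    have ab: "- (\<delta> / 2) \<le> a" "a \<le> \<delta> / 2" "- (\<delta> / 2) \<le> b" "b \<le> \<delta> / 2"
    proof -
      have "p1 - \<delta> / 2 \<le> fst y" "fst y \<le> p1 + \<delta> / 2" "p2 - \<delta> / 2 \<le> snd y" "snd y \<le> p2 + \<delta> / 2"
        using that by (simp_all add: B_def cbox_Pair_eq mem_Times_iff)
      then show "- (\<delta> / 2) \<le> a" "a \<le> \<delta> / 2" "- (\<delta> / 2) \<le> b" "b \<le> \<delta> / 2"
        unfolding a_def b_def by linarith+
    qed
    note \<kappa>ab = ab[THEN mult_left_mono, OF less_imp_le[OF \<kappa>(1)]]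
    have U: "u_coord y 0 = 3 / 4 * \<delta> + (a + \<kappa> * b) / (2 * \<kappa> + 2)"
    proof -
      have "fst y + \<kappa> * snd y = (2 * \<kappa> + 2) * (3 / 4 * \<delta>) + (a + \<kappa> * b)"
        unfolding p12(1)[symmetric] by (simp add: a_def b_def algebra_simps)
      then have "u_coord y 0 = (2 * \<kappa> + 2) * (3 / 4 * \<delta>) / (2 * \<kappa> + 2) + (a + \<kappa> * b) / (2 * \<kappa> + 2)"
        by (simp only: u_coord_def theta_0 add_divide_distrib)
      also have "(2 * \<kappa> + 2) * (3 / 4 * \<delta>) / (2 * \<kappa> + 2) = 3 / 4 * \<delta>"
        using N by (intro nonzero_mult_div_cancel_left) auto
      finally show ?thesis .
    qed
    have S: "s_coord y 0 = 3 / 4 * \<delta> + (\<kappa> * a - b) / (2 * \<kappa> + 2)"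
    proof -
      have "\<kappa> * fst y - snd y = (2 * \<kappa> + 2) * (3 / 4 * \<delta>) + (\<kappa> * a - b)"
        unfolding p12(2)[symmetric] by (simp add: a_def b_def algebra_simps)
      then have "s_coord y 0 = (2 * \<kappa> + 2) * (3 / 4 * \<delta>) / (2 * \<kappa> + 2) + (\<kappa> * a - b) / (2 * \<kappa> + 2)"
        by (simp only: s_coord_def theta_0 add_divide_distrib)
      also have "(2 * \<kappa> + 2) * (3 / 4 * \<delta>) / (2 * \<kappa> + 2) = 3 / 4 * \<delta>"
        using N by (intro nonzero_mult_div_cancel_left) auto
      finally show ?thesis .
    qed
    have "\<bar>a + \<kappa> * b\<bar> \<le> (2 * \<kappa> + 2) * (\<delta> / 4)" "\<bar>\<kappa> * a - b\<bar> \<le> (2 * \<kappa> + 2) * (\<delta> / 4)"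
      using ab \<kappa>ab by (auto simp: abs_le_iff algebra_simps)
    then have "\<bar>(a + \<kappa> * b) / (2 * \<kappa> + 2)\<bar> \<le> \<delta> / 4" "\<bar>(\<kappa> * a - b) / (2 * \<kappa> + 2)\<bar> \<le> \<delta> / 4"
      using N by (simp_all add: abs_divide divide_le_eq mult.commute)
    then have "- (\<delta> / 4) \<le> (a + \<kappa> * b) / (2 * \<kappa> + 2)" "(a + \<kappa> * b) / (2 * \<kappa> + 2) \<le> \<delta> / 4"
      "- (\<delta> / 4) \<le> (\<kappa> * a - b) / (2 * \<kappa> + 2)" "(\<kappa> * a - b) / (2 * \<kappa> + 2) \<le> \<delta> / 4"
      by (simp_all only: abs_le_iff minus_le_iff)
    then have "\<delta> / 2 \<le> u_coord y 0" "u_coord y 0 \<le> \<delta>" "\<delta> / 2 \<le> s_coord y 0" "s_coord y 0 \<le> \<delta>"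
      unfolding U S by linarith+
    then show ?thesis
      unfolding g_def by (rule fibre_lower_bound[OF \<delta> _ _ _ _ m])
  qed
  have B_sub: "B \<subseteq> torus"
  proof -
    have "p1 \<le> 3 / 4 * (1 / 10) * (1 + 2.5)" "p2 \<le> 3 / 4 * (1 / 10) * (2.5 - 1)"
      unfolding p1_def p2_def using \<delta>_bounds \<kappa>_bounds by (intro mult_mono; simp)+
    moreover have "p1 \<ge> 0" "p2 \<ge> 0" unfolding p1_def p2_def using \<delta>_bounds \<kappa>_bounds by auto
    ultimately show ?thesis
      unfolding B_def torus_def cbox_Pair_eq using \<delta>_bounds pi_gt3
      by (intro Sigma_mono) auto
  qed
  have g_int: "g integrable_on torus"
    unfolding g_def by (intro integrable_on_mult_right integrable_sum integrable_fib_q) auto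
  have g_intB: "g integrable_on B"
    unfolding g_def B_def
    by (intro integrable_continuous continuous_intros continuous_on_fib_q)
  have g_nonneg: "g y \<ge> 0" for y
    unfolding g_def by (intro mult_nonneg_nonneg sum_nonneg fib.q_nonneg) auto
  have "\<delta>\<^sup>2 / 2 = integral B (\<lambda>_. 1 / 2)"
    using \<delta>_bounds by (simp add: B_def content_Pair power2_eq_square)
  also have "\<dots> \<le> integral B g"
    by (intro integral_le g_intB bound) (auto simp: B_def)
  also have "\<dots> \<le> integral torus g"
    by (intro integral_subset_le B_sub g_intB g_int) (use g_nonneg in auto)
  also have "\<dots> = real (2 * K + 1) * \<rho>\<^sup>2 * (\<Sum>i\<in>{- int K..int K}. 4 * pi\<^sup>2 * trace_moment 0 m)"
    unfolding g_def by (simp add: integral_sum integrable_fib_q integral_fib_q)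
  also have "\<dots> = real (2 * K + 1) * real (2 * K + 1) * \<rho>\<^sup>2 * (4 * pi\<^sup>2) * trace_moment 0 m"
    by simp
  also have "\<dots> \<le> \<rho> ^ K * \<rho> ^ K * \<rho>\<^sup>2 * 40 * trace_moment 0 m"
  proof -
    have "pi\<^sup>2 \<le> (3.15)\<^sup>2" using pi_approx by (intro power_mono) auto
    then have "4 * pi\<^sup>2 \<le> 40" by (simp add: power2_eq_square)
    then show ?thesis using \<kappa> odd_le_rho_power
      by (intro mult_right_mono[OF _ trace_moment_nonneg] mult_mono) auto
  qed
  finally have 1: "\<delta>\<^sup>2 / 2 \<le> \<rho> ^ K * \<rho> ^ K * \<rho>\<^sup>2 * 40 * trace_moment 0 m" .
  have "\<rho> ^ 5 \<ge> 5 ^ 5" using \<rho>_bounds by (intro power_mono) auto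
  then have 2: "\<rho> ^ 5 \<ge> 2000" by simp
  have "\<delta>\<^sup>2 / 2 * \<rho> ^ (6 * K + 1) = 1 / 50"
    using \<kappa> by (simp add: \<delta>_def power_divide power_mult_distrib \<rho>_def[symmetric] power_mult[symmetric] mult.commute)
  then have "1 / 50 = \<delta>\<^sup>2 / 2 * \<rho> ^ (6 * K + 1)" ..
  also have "\<dots> \<le> \<rho> ^ K * \<rho> ^ K * \<rho>\<^sup>2 * 40 * trace_moment 0 m * \<rho> ^ (6 * K + 1)"
    using 1 \<kappa> by (intro mult_right_mono) auto
  also have "\<dots> = 40 * (\<rho> ^ (K + K + 2 + (6 * K + 1)) * trace_moment 0 m)"
    by (simp only: power_add mult_ac)
  also have "K + K + 2 + (6 * K + 1) = 8 * K + 3" by simp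
  finally have "1 \<le> 2000 * (\<rho> ^ (8 * K + 3) * trace_moment 0 m)" by simp
  also have "\<dots> \<le> \<rho> ^ 5 * (\<rho> ^ (8 * K + 3) * trace_moment 0 m)"
    using 2 \<kappa> trace_moment_nonneg by (intro mult_right_mono mult_nonneg_nonneg) auto
  also have "\<dots> = \<rho> ^ (8 * K + 8) * trace_moment 0 m" by (simp add: power_add mult_ac eval_nat_numeral)
  finally show ?thesis using \<kappa> by (simp add: field_simps)
qed

section \<open>Absence of an atom at zero\<close>

definition lattice_point :: "real \<times> real \<Rightarrow> int \<Rightarrow> bool" where
  "lattice_point y n \<longleftrightarrow> (\<exists>k l :: int. theta1 y n = of_int k * 2 * pi \<and> theta2 y n = of_int l * 2 * pi)"

lemma lattice_point_step: "lattice_point y (n + 1) \<longleftrightarrow> lattice_point y n"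
proof
  assume "lattice_point y (n + 1)"
  then obtain k l where "theta1 y (n + 1) = of_int k * 2 * pi" "theta2 y (n + 1) = of_int l * 2 * pi"
    by (auto simp: lattice_point_def)
  then show "lattice_point y n"
    unfolding lattice_point_def theta_step[of y n]
    by (intro exI[of _ "k + 2 * l"] exI[of _ "2 * k + 5 * l"]) (simp add: algebra_simps)
next
  assume "lattice_point y n"
  then obtain k l where "theta1 y n = of_int k * 2 * pi" "theta2 y n = of_int l * 2 * pi"
    by (auto simp: lattice_point_def)
  moreover have "theta1 y (n + 1) = 5 * theta1 y n - 2 * theta2 y n" "theta2 y (n + 1) = theta2 y n - 2 * theta1 y n"
    using theta_step[of y n] by simp_all
  ultimately show "lattice_point y (n + 1)"
    unfolding lattice_point_def
    by (intro exI[of _ "5 * k - 2 * l"] exI[of _ "l - 2 * k"]) (simp add: algebra_simps)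
qed

lemma lattice_point_0: "lattice_point y n \<longleftrightarrow> lattice_point y 0"
proof (induction n rule: int_induct[where k = 0])
  case (step2 i)
  then show ?case using lattice_point_step[of y "i - 1"] by simp
qed (simp_all add: lattice_point_step)

text \<open>The real part of \<open>fib_alpha y n\<close> is a positive combination of \<open>1 - cos\<close> terms, so it vanishes only if the iterate of \<open>y\<close> is a point of
\<open>2 * pi * \<int>\<^sup>2\<close>; these points are permuted by the dynamics, and the torus contains just one of them.\<close>

lemma fib_alpha_nonzero:
  assumes y: "y \<in> torus" "y \<noteq> (0, 0)"
  shows "fib_alpha y n \<noteq> 0"
proof
  assume "fib_alpha y n = 0"
  then have "Re (fib_alpha y n / complex_of_real wconst) = 0" by simp
  then have "\<kappa> * (1 - cos (theta1 y n)) + (1 - cos (theta2 y n)) = 0"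
    using wconst_pos by (simp add: fib_alpha_eq)
  moreover have "\<kappa> * (1 - cos (theta1 y n)) \<ge> 0" "1 - cos (theta2 y n) \<ge> 0"
    using \<kappa>_bounds by auto
  ultimately have "cos (theta1 y n) = 1" "cos (theta2 y n) = 1"
    using \<kappa>_bounds by (auto simp: add_nonneg_eq_0_iff)
  then have "lattice_point y n"
    unfolding lattice_point_def cos_one_2pi_int by blast
  then have "lattice_point y 0" by (simp add: lattice_point_0[of y n])
  then obtain k l :: int where kl: "fst y = of_int k * 2 * pi" "snd y = of_int l * 2 * pi"
    by (auto simp: lattice_point_def theta_0)
  have zero: "k = 0" if "\<bar>of_int k * 2 * pi\<bar> \<le> pi" for k :: int
  proof -
    have "\<bar>of_int k\<bar> * (2 * pi) \<le> 1 * pi" using that by (simp add: abs_mult)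
    then have "\<bar>real_of_int k\<bar> < 1" using pi_gt_zero by (simp add: mult.assoc[symmetric] del: mult.assoc)
    then show ?thesis by linarith
  qed
  have "- pi \<le> fst y" "fst y \<le> pi" "- pi \<le> snd y" "snd y \<le> pi"
    using y(1) by (simp_all add: torus_def cbox_Pair_eq mem_Times_iff)
  then have "\<bar>fst y\<bar> \<le> pi" "\<bar>snd y\<bar> \<le> pi" by linarith+
  with kl zero[of k] zero[of l] have "y = (0, 0)" by (simp add: prod_eq_iff)
  with y show False by simp
qed

lemma content_torus: "integral torus (\<lambda>_. 1 :: real) = 4 * pi\<^sup>2"
  by (simp add: torus_def content_Pair power2_eq_square)

lemma trace_moment_antimono: "trace_moment 0 (Suc m) \<le> trace_moment 0 m"
  using trace_moment_split[of 0 m] trace_moment_nonneg[of 1 m] by simp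

text \<open>The limit \<open>L\<close> is the average of each diagonal entry of the kernel projections, and \<open>N\<close> of these entries add up to at most 1 in almost every fibre.\<close>

lemma trace_moment_tendsto_0: "(\<lambda>m. trace_moment 0 m) \<longlonglongrightarrow> 0"
proof -
  have "convergent (\<lambda>m. trace_moment 0 m)"
    by (rule Bseq_monoseq_convergent)
       (auto intro!: decseq_bounded[of _ 0] decseq_SucI trace_moment_antimono trace_moment_nonneg simp: monoseq_Suc)
  then obtain L where L: "(\<lambda>m. trace_moment 0 m) \<longlonglongrightarrow> L" by (auto simp: convergent_def)
  define w where "w j y = Re (fib.P y (int j) (int j))" for j y
  have w: "w j integrable_on torus \<and> integral torus (w j) = 4 * pi\<^sup>2 * L" for j
  proof -
    have lim: "(\<lambda>m. integral torus (\<lambda>y. fib.q y 0 m (unit_vec (int j)))) \<longlonglongrightarrow> 4 * pi\<^sup>2 * L"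
      unfolding integral_fib_q by (intro tendsto_intros L)
    have *: "w j integrable_on torus \<and> (\<lambda>m. integral torus (\<lambda>y. fib.q y 0 m (unit_vec (int j)))) \<longlonglongrightarrow> integral torus (w j)"
    proof (rule monotone_convergence_decreasing)
      show "bounded (range (\<lambda>m. integral torus (\<lambda>y. fib.q y 0 m (unit_vec (int j)))))"
        using convergent_imp_bounded[OF lim] by simp
      show "(\<lambda>m. fib.q y 0 m (unit_vec (int j))) \<longlonglongrightarrow> w j y" for y
        using fib.P_diag_tendsto[of y "int j"] by (simp add: w_def fib.t_diag)
    qed (auto intro: integrable_fib_q fib.q_antimono_right)
    then show ?thesis using LIMSEQ_unique[OF lim] by auto
  qed
  have "real N * L \<le> 1" for N
  proof -
    \<comment> \<open>at \<open>y = 0\<close> both diagonals vanish identically, so \<open>D\<close> is zero and the bound on the trace fails\<close>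
    define g where "g y = (if y = (0, 0) then 0 else \<Sum>j<N. w j y)" for y
    have spike: "negligible {(0 :: real, 0 :: real)}" by simp
    have int: "(\<lambda>y. \<Sum>j<N. w j y) integrable_on torus" using w by (intro integrable_sum) auto
    have "real N * (4 * pi\<^sup>2 * L) = (\<Sum>j<N. integral torus (w j))" by (simp add: w)
    also have "\<dots> = integral torus (\<lambda>y. \<Sum>j<N. w j y)" using w by (intro integral_sum[symmetric]) auto
    also have "\<dots> = integral torus g" by (rule integral_spike[OF spike]) (auto simp: g_def)
    also have "\<dots> \<le> integral torus (\<lambda>_. 1 :: real)"
    proof (rule integral_le)
      show "g integrable_on torus" by (rule integrable_spike[OF int spike]) (auto simp: g_def)
      show "(\<lambda>_. 1 :: real) integrable_on torus" by (simp add: torus_def integrable_const)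
      fix y assume "y \<in> torus"
      then show "g y \<le> 1"
        using fib.P_trace_le_1[of y N] fib_alpha_nonzero[of y] by (auto simp: g_def w_def)
    qed
    also have "\<dots> = 4 * pi\<^sup>2" by (rule content_torus)
    finally show ?thesis by (simp add: mult.left_commute)
  qed
  moreover have "L \<ge> 0" by (rule LIMSEQ_le_const[OF L]) (auto intro: trace_moment_nonneg)
  ultimately have "L = 0" by (metis ex_less_of_nat_mult less_eq_real_def not_less)
  with L show ?thesis by simp
qed

lemma moment_0: "moment 0 = 1"
  by (simp add: moment_def delta_one_def)

lemma trace_moment_0_0: "trace_moment 0 0 = 1"
  by (simp add: trace_moment_0_right moment_0)

section \<open>Vanishing of the Novikov--Shubin invariant\<close>

lemma Liminf_le_filterlim:
  assumes "filterlim e F G"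
  shows "Liminf F f \<le> Liminf G (\<lambda>x. f (e x) :: ereal)"
proof (subst le_Liminf_iff, intro allI impI)
  fix y assume "y < Liminf F f"
  then have "\<forall>\<^sub>F x in F. y < f x" using le_Liminf_iff[of "Liminf F f" F f] by auto
  then show "\<forall>\<^sub>F x in G. y < f (e x)" using assms by (rule eventually_compose_filterlim)
qed

theorem theorem1p4:
  shows "\<exists>(A :: int ^ 2 ^ 2) (H :: (int ^ 2) \<times> int \<Rightarrow> complex).
    det A = 1 \<and> hyperbolic_matrix A \<and>
    corresponds_to_random_walk (semidirect A) H \<and>
    novikov_shubin (semidirect A) H = 0"
proof -
  obtain M where "real_distribution M" and M01: "AE x in M. 0 \<le> x \<and> x \<le> 1"
    and M: "\<And>k. integral\<^sup>L M (\<lambda>x. x ^ k) = trace_moment k 0"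
    using hausdorff_moment[of trace_moment, OF trace_moment_nonneg trace_moment_0_0 trace_moment_split] by blast
  then interpret unit_interval_distribution M
    by (simp add: unit_interval_distribution_def unit_interval_distribution_axioms_def)
  have int_M: "integrable M (\<lambda>x. x ^ k)" for k using integrable_mono[of k 0] by simp
  have spec: "spectral_measure Sol walk = M"
    unfolding spectral_measure_def
  proof (rule the_equality)
    show "sets M = sets borel \<and> (\<forall>k. integrable M (\<lambda>x. x ^ k) \<and>
        ell2_inner Sol (delta_one Sol) ((convolve Sol walk ^^ k) (delta_one Sol)) = complex_of_real (\<integral>x. x ^ k \<partial>M))"
      by (simp add: int_M M trace_moment_0_right complex_of_real_moment)
  next
    fix \<nu> :: "real measure"
    assume \<nu>: "sets \<nu> = sets borel \<and> (\<forall>k. integrable \<nu> (\<lambda>x. x ^ k) \<and>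
        ell2_inner Sol (delta_one Sol) ((convolve Sol walk ^^ k) (delta_one Sol)) = complex_of_real (\<integral>x. x ^ k \<partial>\<nu>))"
    then have mom: "(\<integral>x. x ^ k \<partial>\<nu>) = moment k" for k
      by (metis complex_of_real_moment of_real_eq_iff)
    have "integrable \<nu> (\<lambda>x. 1 :: real)" using \<nu>[THEN conjunct2, THEN spec, of 0] by simp
    then have "emeasure \<nu> (space \<nu>) < \<infinity>" by (simp add: integrable_iff_bounded)
    then have "finite_measure \<nu>" by (intro finite_measureI) simp
    then have "prob_space \<nu>"
      using mom[of 0] moment_0 by (simp add: prob_space_def prob_space_axioms_def finite_measure.emeasure_eq_measure)
    then have "real_distribution \<nu>"
      using \<nu> by (simp add: real_distribution_def real_distribution_axioms_def)
    moreover have "expectation (\<lambda>x. x ^ k) \<le> 1" for k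
    proof -
      have "AE x in M. x ^ k \<le> 1"
        using AE_unit by eventually_elim (auto intro: power_le_one)
      then have "expectation (\<lambda>x. x ^ k) \<le> expectation (\<lambda>x. 1)"
        by (intro integral_mono_AE int_M) auto
      then show ?thesis using prob_space by simp
    qed
    ultimately show "\<nu> = M"
      using \<nu> by (intro moments_determine_measure) (auto simp: int_M mom M trace_moment_0_right real_distribution_axioms)
  qed
  have mix: "expectation (\<lambda>x. (1 - x) ^ m) = trace_moment 0 m" for m
    using mixed_moments[of trace_moment 0 m, OF trace_moment_split M] by simp
  have "measure M {0} \<le> 0"
    by (rule LIMSEQ_le_const[OF trace_moment_tendsto_0]) (use measure_0_le mix in auto)
  then have M0: "measure M {0} = 0" by (simp add: measure_le_0_iff)
  define f where "f \<epsilon> = elog (measure M {- \<epsilon><..<\<epsilon>}) / elog \<epsilon>" for \<epsilon>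
  have ns: "novikov_shubin Sol walk = Liminf (at_right 0) f"
    by (simp add: novikov_shubin_def spec M0 f_def[abs_def])
  have lower: "0 \<le> Liminf (at_right 0) f"
  proof (rule Liminf_bounded)
    have "\<forall>\<^sub>F \<epsilon> in at_right 0. 0 < \<epsilon> \<and> \<epsilon> < (1 :: real)"
      by (auto simp: eventually_at_right_field intro!: exI[of _ 1])
    then show "\<forall>\<^sub>F \<epsilon> in at_right 0. 0 \<le> f \<epsilon>"
    proof eventually_elim
      case (elim \<epsilon>)
      let ?x = "measure M {- \<epsilon><..<\<epsilon>}"
      have l: "elog \<epsilon> = ereal (ln \<epsilon>)" "ln \<epsilon> < 0" using elim by (auto simp: elog_def)
      show ?case
      proof (cases "?x \<le> 0")
        case True
        then show ?thesis using l by (simp add: f_def elog_def)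
      next
        case False
        then have "elog ?x = ereal (ln ?x)" "ln ?x \<le> 0" by (auto simp: elog_def)
        then show ?thesis using l by (simp add: f_def divide_nonpos_neg)
      qed
    qed
  qed
  have \<rho>: "\<rho> \<ge> 5" "\<rho> > 0" "\<rho> \<ge> 1" using \<rho>_bounds by auto
  have mass: "1 / \<rho> ^ (8 * K + 9) \<le> measure M {- (1 / \<rho> ^ (K\<^sup>2))<..<1 / \<rho> ^ (K\<^sup>2)}" if K: "K \<ge> 13" for K
  proof -
    \<comment> \<open>13 is the least \<open>K\<close> for which the second inequality holds\<close>
    have KK: "4 * K \<le> K\<^sup>2" "8 * K + 9 \<le> K\<^sup>2 - 4 * K"
    proof -
      have "13 * K \<le> K\<^sup>2" using K by (simp add: power2_eq_square)
      then show "4 * K \<le> K\<^sup>2" "8 * K + 9 \<le> K\<^sup>2 - 4 * K" using K by linarith+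
    qed
    \<comment> \<open>\<open>m\<close> has to be much larger than \<open>1 / \<epsilon>\<close> but not exceed the inverse of \<open>\<parallel>D f\<parallel>\<^sup>2\<close>, which is of order \<open>X\<close>\<close>
    define X where "X = \<rho> ^ (2 * K\<^sup>2 - 4 * K)"
    define m where "m = nat \<lfloor>X\<rfloor>"
    define \<epsilon> where "\<epsilon> = 1 / \<rho> ^ (K\<^sup>2)"
    have X1: "X \<ge> 1" unfolding X_def using \<rho> by (intro one_le_power)
    have m: "real m \<le> X" "X / 2 \<le> real m" "m > 0"
    proof -
      have "\<lfloor>X\<rfloor> \<ge> 1" using X1 by simp
      then have mX: "real m = of_int \<lfloor>X\<rfloor>" "m > 0" by (simp_all add: m_def)
      moreover have "real_of_int \<lfloor>X\<rfloor> \<ge> 1" using \<open>\<lfloor>X\<rfloor> \<ge> 1\<close> by (simp only: of_int_1_le_iff)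
      moreover have "real_of_int \<lfloor>X\<rfloor> \<le> X" "X < real_of_int \<lfloor>X\<rfloor> + 1"
        using floor_correct[of X] by simp_all
      ultimately show "real m \<le> X" "X / 2 \<le> real m" "m > 0" by linarith+
    qed
    have "X * \<rho> ^ (4 * K) = \<rho> ^ (2 * K\<^sup>2)"
      unfolding X_def power_add[symmetric] using KK by simp
    then have "real m * \<rho> ^ (4 * K) \<le> \<rho> ^ (2 * K\<^sup>2)"
      using m \<rho> by (metis mult_right_mono zero_le_power less_imp_le)
    from trace_moment_lower_bound[OF this]
    have 1: "1 / \<rho> ^ (8 * K + 8) \<le> trace_moment 0 m" .
    have \<epsilon>: "0 < \<epsilon>" "\<epsilon> \<le> 1" unfolding \<epsilon>_def using \<rho> by (auto simp: one_le_power)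
    have "2 * \<rho> ^ (8 * K + 8) \<le> \<rho> / 2 * \<rho> ^ (8 * K + 8)" using \<rho> by (intro mult_right_mono) auto
    also have "\<dots> = \<rho> ^ (8 * K + 9) / 2" by (simp add: eval_nat_numeral)
    also have "\<dots> \<le> \<rho> ^ (K\<^sup>2 - 4 * K) / 2"
      using \<rho> KK by (intro divide_right_mono power_increasing) auto
    also have "\<dots> = X / 2 * \<epsilon>"
    proof -
      have "2 * K\<^sup>2 - 4 * K = (K\<^sup>2 - 4 * K) + K\<^sup>2" using KK by simp
      then have "X = \<rho> ^ (K\<^sup>2 - 4 * K) * \<rho> ^ (K\<^sup>2)" unfolding X_def by (metis power_add)
      then show ?thesis unfolding \<epsilon>_def using \<rho> by simp
    qed
    also have "\<dots> \<le> real m * \<epsilon>" using m \<epsilon> by (intro mult_right_mono) auto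
    finally have 2: "2 * \<rho> ^ (8 * K + 8) \<le> real m * \<epsilon>" .
    have "(1 - \<epsilon>) ^ m \<le> 1 / (real m * \<epsilon>)" by (rule one_minus_power_le[OF \<epsilon> m(3)])
    also have "\<dots> \<le> 1 / (2 * \<rho> ^ (8 * K + 8))" using 2 \<rho> by (intro frac_le) auto
    finally have 3: "(1 - \<epsilon>) ^ m \<le> 1 / \<rho> ^ (8 * K + 8) / 2" by simp
    have "1 / \<rho> ^ (8 * K + 9) = 1 / \<rho> ^ (8 * K + 8) / \<rho>" by (simp add: eval_nat_numeral)
    also have "\<dots> \<le> 1 / \<rho> ^ (8 * K + 8) / 2" using \<rho> by (intro frac_le) auto
    also have "\<dots> \<le> measure M {- \<epsilon><..<\<epsilon>}"
      using expectation_power_le[OF \<epsilon>, of m] 1 3 unfolding mix by linarith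
    finally show ?thesis unfolding \<epsilon>_def .
  qed
  define e where "e K = 1 / \<rho> ^ (K\<^sup>2)" for K
  have e_lim: "filterlim e (at_right 0) sequentially"
  proof -
    have "(\<lambda>K. (1 / \<rho>) ^ (K\<^sup>2)) \<longlonglongrightarrow> 0"
    proof -
      have "(\<lambda>n. (1 / \<rho>) ^ n) \<longlonglongrightarrow> 0" using \<rho> by (intro LIMSEQ_power_zero) auto
      moreover have "strict_mono (\<lambda>K :: nat. K\<^sup>2)"
        by (intro strict_monoI power_strict_mono) auto
      ultimately have "((\<lambda>n. (1 / \<rho>) ^ n) \<circ> (\<lambda>K. K\<^sup>2)) \<longlonglongrightarrow> 0"
        by (rule LIMSEQ_subseq_LIMSEQ)
      then show ?thesis by (simp only: o_def)
    qed
    then have "e \<longlonglongrightarrow> 0" by (simp add: e_def[abs_def] power_one_over)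
    then show ?thesis
      by (rule tendsto_imp_filterlim_at_right) (use \<rho> in \<open>auto simp: e_def\<close>)
  qed
  have "Liminf (at_right 0) f \<le> Liminf sequentially (\<lambda>K. f (e K))"
    by (rule Liminf_le_filterlim[OF e_lim])
  also have "\<dots> \<le> Liminf sequentially (\<lambda>K. ereal ((8 * real K + 9) / (real K)\<^sup>2))"
  proof (rule Liminf_mono)
    show "\<forall>\<^sub>F K in sequentially. f (e K) \<le> ereal ((8 * real K + 9) / (real K)\<^sup>2)"
      using eventually_ge_at_top[of 13]
    proof eventually_elim
      case (elim K)
      let ?x = "measure M {- e K<..<e K}"
      have x: "1 / \<rho> ^ (8 * K + 9) \<le> ?x" using mass[OF elim] by (simp add: e_def)
      have pos: "0 < 1 / \<rho> ^ (8 * K + 9)" using \<rho> by simp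
      have ln\<rho>: "ln \<rho> > 0" using \<rho> by simp
      have "ln (1 / \<rho> ^ (8 * K + 9)) \<le> ln ?x" using x pos less_le_trans[OF pos x] by (subst ln_le_cancel_iff)
      then have lx: "- ((8 * real K + 9) * ln \<rho>) \<le> ln ?x"
        using \<rho> by (simp add: ln_div ln_realpow)
      have le: "ln (e K) = - ((real K)\<^sup>2 * ln \<rho>)" using \<rho> by (simp add: e_def ln_div ln_realpow)
      have K2: "(real K)\<^sup>2 * ln \<rho> > 0" using ln\<rho> elim by simp
      have "e K > 0" "?x > 0" using less_le_trans[OF pos x] \<rho> by (auto simp: e_def)
      then have "elog ?x = ereal (ln ?x)" "elog (e K) = ereal (ln (e K))"
        by (simp_all add: elog_def)
      moreover have "ln (e K) \<noteq> 0" using K2 le by linarith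
      ultimately have "f (e K) = ereal (ln ?x / ln (e K))"
        unfolding f_def by (simp only: ereal_divide if_False)
      also have "ln ?x / ln (e K) = - ln ?x / ((real K)\<^sup>2 * ln \<rho>)" by (simp add: le)
      also have "\<dots> \<le> ((8 * real K + 9) * ln \<rho>) / ((real K)\<^sup>2 * ln \<rho>)"
        using lx K2 by (intro divide_right_mono) auto
      also have "\<dots> = (8 * real K + 9) / (real K)\<^sup>2" using ln\<rho> by simp
      finally show ?case by simp
    qed
  qed
  also have "\<dots> = 0"
  proof -
    have "(\<lambda>K. (8 * real K + 9) / (real K)\<^sup>2) \<longlonglongrightarrow> 0" by real_asymp
    then have "(\<lambda>K. ereal ((8 * real K + 9) / (real K)\<^sup>2)) \<longlonglongrightarrow> ereal 0" by simp
    then show ?thesis using lim_imp_Liminf[OF sequentially_bot] by (metis zero_ereal_def)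
  qed
  finally have "novikov_shubin Sol walk = 0" using lower by (simp add: ns)
  then show ?thesis
    using det_hyp_mat hyperbolic_hyp_mat walk_random_walk by blast
qed

end
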